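(* For any infinite constellation $S$ of complex dimension $nt$ with NLD $\delta$, transmitted over $n$ uses of the $t\times r$ MIMO fast fading channel ($t\le r$) described in the context, the average error probability satisfies $$P_e(S)\ge\Pr\left\{\|\mathbf z'^n\|^2\ge e^{-\delta/t}\left(\frac{\det(\mathbf H^{n\dagger}\mathbf H^n)}{V_{2nt}}\right)^{\frac1{nt}}\right\},$$ where $\mathbf z'^n\sim CN(0,\sigma^2I_{nt})$ is independent of $\mathbf H^n$ and $V_{2nt}=\frac{\pi^{nt}}{nt\,\Gamma(nt)}$ is the volume of the unit ball in $\mathbb R^{2nt}$.
   Context: Channel: $\mathbf y_i=\mathbf H_i\mathbf x_i+\mathbf z_i$, $\mathbf x_i\in\mathbb C^t$, $\mathbf H_i\in\mathbb C^{r\times t}$ i.i.d. over $i$ with i.i.d. circularly symmetric $CN(0,1)$ entries, $\mathbf z_i\sim CN(0,\sigma^2I_r)$ i.i.d., all independent, receiver knows $\mathbf H_i$, $t\le r$. $\mathbf H^n=\mathrm{diag}(\mathbf H_1,\dots,\mathbf H_n)$ (block diagonal). An IC of complex dimension $l=nt$ is a countable $S\subset\mathbb C^l$; $\mathrm{Cb}(a,l)=\{\mathbf x\in\mathbb C^l:|\mathrm{Re}x_i|,|\mathrm{Im}x_i|<a/2\}$; density $\gamma=\limsup_a|S\cap\mathrm{Cb}(a,l)|/a^{2l}$; NLD $\delta=\frac1n\ln\gamma$. $P_e(S)=E\{\limsup_a\frac{1}{M(S_{\mathbf H^n},a)}\sum_{s_{rc}\in S_{\mathbf H^n}\cap\mathbf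 H^n\mathrm{Cb}(a,l)}\Pr\{s_{rc}+\mathbf z^n\notin W(s_{rc})\mid\mathbf H^n\}\}$ with $S_{\mathbf H^n}=\{\mathbf H^ns:s\in S\}$, $M(S_{\mathbf H^n},a)=|S_{\mathbf H^n}\cap\mathbf H^n\mathrm{Cb}(a,l)|$, $W$ the Voronoi cell in $S_{\mathbf H^n}$. *)

theory Defs
  imports "HOL-Probability.Probability"
begin

text \<open>Complex vectors in C^l are represented canonically as functions nat => complex
  that vanish at indices >= l.  Noise/channel samples come from PiM and are only
  ever inspected at indices inside their index set.\<close>

definition cvec :: "nat \<Rightarrow> (nat \<Rightarrow> complex) set" where
  "cvec l = {x. \<forall>i\<ge>l. x i = 0}"

definition cnorm2 :: "nat \<Rightarrow> (nat \<Rightarrow> complex) \<Rightarrow> real" where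
  "cnorm2 m x = (\<Sum>i<m. (cmod (x i))\<^sup>2)"

definition Cb :: "real \<Rightarrow> nat \<Rightarrow> (nat \<Rightarrow> complex) set" where
  "Cb a l = {x \<in> cvec l. \<forall>i<l. \<bar>Re (x i)\<bar> < a / 2 \<and> \<bar>Im (x i)\<bar> < a / 2}"

definition npts :: "'a set \<Rightarrow> ennreal" where
  "npts A = emeasure (count_space UNIV) A"

definition IC_density :: "nat \<Rightarrow> (nat \<Rightarrow> complex) set \<Rightarrow> ennreal" where
  "IC_density l S = Limsup at_top (\<lambda>a::real. npts (S \<inter> Cb a l) / ennreal (a ^ (2 * l)))"

text \<open>Normalized log density delta = (1/n) ln gamma (for 0 < gamma < infinity).\<close>
definition NLD :: "nat \<Rightarrow> nat \<Rightarrow> (nat \<Rightarrow> complex) set \<Rightarrow> real" where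
  "NLD n t S = ln (enn2real (IC_density (n * t) S)) / real n"

definition CN :: "real \<Rightarrow> complex measure" where
  "CN s2 = density lborel (\<lambda>z. ennreal (exp (- (cmod z)\<^sup>2 / s2) / (pi * s2)))"

definition noise :: "nat \<Rightarrow> real \<Rightarrow> (nat \<Rightarrow> complex) measure" where
  "noise m s2 = PiM {..<m} (\<lambda>_. CN s2)"

text \<open>The channel matrices: H (i,j,k) is entry (j,k) of H_i, i<n, j<r, k<t, i.i.d. CN(0,1).\<close>
definition chan :: "nat \<Rightarrow> nat \<Rightarrow> nat \<Rightarrow> (nat \<times> nat \<times> nat \<Rightarrow> complex) measure" where
  "chan n r t = PiM ({..<n} \<times> {..<r} \<times> {..<t}) (\<lambda>_. CN 1)"

text \<open>Entries of the (n r) x (n t) block diagonal matrix H^n = diag(H_1,...,H_n).\<close>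
definition Hblock :: "nat \<Rightarrow> nat \<Rightarrow> (nat \<times> nat \<times> nat \<Rightarrow> complex) \<Rightarrow> nat \<Rightarrow> nat \<Rightarrow> complex" where
  "Hblock r t H c a = (if c div r = a div t then H (c div r, c mod r, a mod t) else 0)"

definition Happ :: "nat \<Rightarrow> nat \<Rightarrow> nat \<Rightarrow> (nat \<times> nat \<times> nat \<Rightarrow> complex) \<Rightarrow> (nat \<Rightarrow> complex) \<Rightarrow> (nat \<Rightarrow> complex)" where
  "Happ n r t H x = (\<lambda>c. if c < n * r then (\<Sum>a<n * t. Hblock r t H c a * x a) else 0)"

definition cdet :: "nat \<Rightarrow> (nat \<Rightarrow> nat \<Rightarrow> complex) \<Rightarrow> complex" where
  "cdet m A = (\<Sum>p | p permutes {..<m}. of_int (sign p) * (\<Prod>i<m. A i (p i)))"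

definition gram_det :: "nat \<Rightarrow> nat \<Rightarrow> nat \<Rightarrow> (nat \<times> nat \<times> nat \<Rightarrow> complex) \<Rightarrow> real" where
  "gram_det n r t H = Re (cdet (n * t)
      (\<lambda>a b. \<Sum>c<n * r. cnj (Hblock r t H c a) * Hblock r t H c b))"

definition voronoi :: "nat \<Rightarrow> (nat \<Rightarrow> complex) set \<Rightarrow> (nat \<Rightarrow> complex) \<Rightarrow> (nat \<Rightarrow> complex) set" where
  "voronoi m P s = {y. \<forall>p\<in>P. cnorm2 m (\<lambda>i. y i - s i) \<le> cnorm2 m (\<lambda>i. y i - p i)}"

definition avg_err :: "nat \<Rightarrow> nat \<Rightarrow> nat \<Rightarrow> real \<Rightarrow> (nat \<Rightarrow> complex) set
    \<Rightarrow> (nat \<times> nat \<times> nat \<Rightarrow> complex) \<Rightarrow> real \<Rightarrow> real" where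
  "avg_err n r t s2 S H a =
     (let SH = Happ n r t H ` S;
          C = SH \<inter> Happ n r t H ` Cb a (n * t)
      in (\<Sum>s\<in>C. measure (noise (n * r) s2)
              {z \<in> space (noise (n * r) s2). (\<lambda>i. s i + z i) \<notin> voronoi (n * r) SH s})
         / real (card C))"

definition error_prob :: "nat \<Rightarrow> nat \<Rightarrow> nat \<Rightarrow> real \<Rightarrow> (nat \<Rightarrow> complex) set \<Rightarrow> ennreal" where
  "error_prob n r t s2 S =
     (\<integral>\<^sup>+ H. Limsup at_top (\<lambda>a. ennreal (avg_err n r t s2 S H a)) \<partial>chan n r t)"

text \<open>Volume of the unit ball in R^(2 n t).\<close>
definition Vball :: "nat \<Rightarrow> real" where
  "Vball k = pi ^ k / (real k * Gamma (real k))"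

end

theory Submission
  imports Defs "Jordan_Normal_Form.Determinant"
begin

text \<open>
  Fix a channel matrix \<open>H\<close> of full column rank and put \<open>q u = |H u|\<^sup>2\<close>. Only the component of the noise
  in the range of \<open>H\<close> decides whether the decoder errs; in the coordinates \<open>u\<close> of that range it has density
  proportional to \<open>exp (- q u / s2)\<close>, and the correct decisions form the Voronoi cell of the
  constellation with respect to \<open>q\<close>. The cells of the points in a cube, cut off at distance \<open>\<rho>\<close>, are
  disjoint up to null sets and fit into a slightly larger cube, so their average volume is asymptotically
  at most \<open>1 / \<gamma>\<close>. Among the sets of given volume the ball \<open>q u < R\<close> captures most noise: this is the
  pointwise inequality behind \<open>bathtub\<close>, which is linear in the cell and hence can be averaged without
  convexity arguments. The radius with volume \<open>1 / \<gamma>\<close> is the one in the theorem, because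
  \<open>u \<mapsto> q u\<close> and \<open>u \<mapsto> |u|\<^sup>2\<close> have the same distribution under Lebesgue measure up to the factor
  \<open>det (H\<^sup>\<dagger> H)\<close>.
\<close>

section \<open>Lebesgue and Gaussian measure on complex vectors\<close>

text \<open>The density is an upper limit, so a cube holds nearly \<open>\<gamma>\<close> times its
  volume in points only for arbitrarily large sizes, not eventually. The average error is an upper
  limit too, and a bound along those sizes is therefore enough. Cells are cut off because they may
  have infinite volume. The price is the Gaussian mass outside the cut; it is the same for every
  point and is made small before the cube grows. The multiplier \<open>exp (- R / s)\<close> in
  \<open>bathtub\<close> is the value of the noise density on the sphere \<open>q u = R\<close>.
  Averaging over the points of a cube leaves this multiplier times the difference between average
  cell volume and ball volume, which is asymptotically at most 0 along the chosen cubes once the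
  ball has volume \<open>1 / \<gamma>\<close>. Channels without full column rank are negligible,
  because a suitable minor of each channel matrix is a nonzero polynomial in its Gaussian
  entries.\<close>

abbreviation LC :: "'i set \<Rightarrow> ('i \<Rightarrow> complex) measure" where
  "LC I \<equiv> PiM I (\<lambda>_. lborel)"

interpretation lborel_pi: product_sigma_finite "\<lambda>_::'i. lborel :: complex measure"
  by standard

text \<open>Write \<open>exp (- v)\<close> as the integral of \<open>exp (- y)\<close> over
  \<open>y > v\<close> and exchange integrals. It is used in both directions: the area of a disc
  gives the Gaussian integral over the plane, and the Gaussian integral over C^l gives the volume of
  the ball.\<close>

lemma nn_integral_layer_cake:
  fixes f :: "'a \<Rightarrow> real"
  assumes "sigma_finite_measure M" and f [measurable]: "f \<in> borel_measurable M"
    and "\<And>x. x \<in> space M \<Longrightarrow> f x \<ge> 0"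
  shows "(\<integral>\<^sup>+x. ennreal (exp (- f x)) \<partial>M) =
    (\<integral>\<^sup>+y. ennreal (exp (- y)) * indicator {0..} y * emeasure M {x \<in> space M. f x < y} \<partial>lborel)"
proof -
  interpret M: sigma_finite_measure M by fact
  interpret P: pair_sigma_finite M lborel by standard
  have "(\<integral>\<^sup>+x. ennreal (exp (- f x)) \<partial>M) =
      (\<integral>\<^sup>+x. \<integral>\<^sup>+y. ennreal (exp (- y)) * indicator {f x<..} y \<partial>lborel \<partial>M)"
  proof (rule nn_integral_cong)
    fix x
    \<comment> \<open>The open half-line yields the strict sublevel set; its endpoint is restored as
      a null set so that the fundamental theorem applies.\<close>
    have "(\<integral>\<^sup>+y. ennreal (exp (- y)) * indicator {f x<..} y \<partial>lborel)
        = (\<integral>\<^sup>+y. ennreal (exp (- y)) * indicator {f x..} y \<partial>lborel)"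
      by (rule nn_integral_cong_AE, use AE_lborel_singleton[of "f x"] in eventually_elim)
         (auto split: split_indicator)
    also have "\<dots> = ennreal (0 - (- exp (- f x)))"
    proof (rule nn_integral_FTC_atLeast)
      show "((\<lambda>y::real. - exp (- y)) \<longlongrightarrow> 0) at_top"
        by (rule tendsto_eq_rhs[OF tendsto_minus[OF
              filterlim_compose[OF exp_at_bot filterlim_uminus_at_bot_at_top]]]) simp
    qed (auto intro!: derivative_eq_intros)
    finally show "ennreal (exp (- f x)) =
        (\<integral>\<^sup>+y. ennreal (exp (- y)) * indicator {f x<..} y \<partial>lborel)" by simp
  qed
  also have "\<dots> = (\<integral>\<^sup>+y. \<integral>\<^sup>+x. ennreal (exp (- y)) * indicator {f x<..} y \<partial>M \<partial>lborel)"
    by (rule P.Fubini'[symmetric]) (simp add: split_beta' indicator_def)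
  also have "\<dots> = (\<integral>\<^sup>+y. ennreal (exp (- y)) * indicator {0..} y
      * emeasure M {x \<in> space M. f x < y} \<partial>lborel)"
  proof (rule nn_integral_cong)
    fix y :: real
    have "(\<integral>\<^sup>+x. ennreal (exp (- y)) * indicator {f x<..} y \<partial>M)
       = (\<integral>\<^sup>+x. ennreal (exp (- y)) * indicator {0..} y * indicator {x \<in> space M. f x < y} x \<partial>M)"
      by (rule nn_integral_cong) (use assms(3) in \<open>force split: split_indicator\<close>)
    also have "\<dots> = ennreal (exp (- y)) * indicator {0..} y
      * emeasure M {x \<in> space M. f x < y}"
      by (rule nn_integral_cmult_indicator) simp
    finally show "(\<integral>\<^sup>+x. ennreal (exp (- y)) * indicator {f x<..} y \<partial>M) = \<dots>" .
  qed
  finally show ?thesis .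
qed

section \<open>Gaussian integrals over the complex plane\<close>

lemma emeasure_disc:
  "emeasure lborel {z::complex. (cmod z)\<^sup>2 < y} = ennreal (pi * y)" if "0 \<le> y"
proof -
  have "{z::complex. (cmod z)\<^sup>2 < y} = ball 0 (sqrt y)"
  proof -
    have "(cmod z)\<^sup>2 < y \<longleftrightarrow> cmod z < sqrt y" for z
      by (metis norm_ge_zero real_sqrt_abs abs_of_nonneg real_sqrt_less_iff)
    then show ?thesis unfolding ball_def dist_norm by simp
  qed
  then show ?thesis
    \<comment> \<open>The instance \<open>Num.One\<close> selects real dimension 2, where the unit
      ball has volume \<open>pi\<close>.\<close>
    using that by (simp add: emeasure_ball unit_ball_vol_numeral(1)[of Num.One] eval_nat_numeral)
qed

text \<open>The factor \<open>1 / c\<^sup>2\<close> reflects the real dimension 2 of the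
  plane.\<close>

lemma nn_integral_complex_scale:
  fixes f :: "complex \<Rightarrow> ennreal"
  assumes [measurable]: "f \<in> borel_measurable borel" and "c > 0"
  shows "(\<integral>\<^sup>+z. f (w + of_real c * z) \<partial>lborel) = ennreal (1 / c\<^sup>2) * (\<integral>\<^sup>+z. f z \<partial>lborel)"
proof -
  have "(\<integral>\<^sup>+z. f z \<partial>lborel) = ennreal (c\<^sup>2) * (\<integral>\<^sup>+z. f (w + of_real c * z) \<partial>lborel)"
    using assms(2) by (subst lborel_affine[of c w])
      (auto simp: nn_integral_density nn_integral_distr nn_integral_cmult scaleR_conv_of_real)
  then show ?thesis
    using assms(2) by (simp flip: mult.assoc ennreal_mult)
qed

lemma nn_integral_gaussian_complex:
  assumes "s > 0"
  shows "(\<integral>\<^sup>+z. ennreal (exp (- (cmod z)\<^sup>2 / s)) \<partial>lborel) = ennreal (pi * s)"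
proof -
  have "(\<integral>\<^sup>+z. ennreal (exp (- (cmod z)\<^sup>2)) \<partial>lborel) =
      (\<integral>\<^sup>+y. ennreal (exp (- y)) * indicator {0..} y * emeasure lborel {z::complex. (cmod z)\<^sup>2 < y} \<partial>lborel)"
    by (subst nn_integral_layer_cake) (auto intro: lborel.sigma_finite_measure_axioms)
  also have "\<dots> = (\<integral>\<^sup>+y. ennreal pi * (ennreal (y ^ 1 * exp (- y)) * indicator {0..} y) \<partial>lborel)"
    by (rule nn_integral_cong)
      (auto simp: emeasure_disc ennreal_mult' ac_simps split: split_indicator)
  also have "\<dots> = ennreal pi"
    using nn_intergal_power_times_exp_Ici[of 1] by (subst nn_integral_cmult) auto
  finally have 1: "(\<integral>\<^sup>+z. ennreal (exp (- (cmod z)\<^sup>2)) \<partial>lborel) = ennreal pi" .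
  \<comment> \<open>Dividing \<open>z\<close> by \<open>sqrt s\<close> reduces the general case to
    the integral just computed.\<close>
  have "(\<integral>\<^sup>+z. ennreal (exp (- (cmod (0 + of_real (1 / sqrt s) * z))\<^sup>2)) \<partial>lborel) = ennreal (s * pi)"
    using assms
    by (subst nn_integral_complex_scale[of "\<lambda>z. ennreal (exp (- (cmod z)\<^sup>2))"])
       (auto simp: 1 power_divide ennreal_mult')
  then show ?thesis
    using assms by (simp add: norm_divide power_divide mult.commute)
qed

lemma nn_integral_CN_density:
  assumes "s > 0"
  shows "(\<integral>\<^sup>+z. ennreal (exp (- (cmod z)\<^sup>2 / s) / (pi * s)) \<partial>lborel) = 1"
proof -
  have "(\<integral>\<^sup>+z. ennreal (exp (- (cmod z)\<^sup>2 / s) / (pi * s)) \<partial>lborel) =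
      (\<integral>\<^sup>+z. ennreal (1 / (pi * s)) * ennreal (exp (- (cmod z)\<^sup>2 / s)) \<partial>lborel)"
    using assms by (intro nn_integral_cong) (simp flip: ennreal_mult')
  also have "\<dots> = ennreal (1 / (pi * s)) * ennreal (pi * s)"
    unfolding nn_integral_gaussian_complex[OF assms, symmetric]
    by (rule nn_integral_cmult) simp
  also have "\<dots> = 1"
    using assms by (simp flip: ennreal_mult')
  finally show ?thesis .
qed

section \<open>Complex Gaussian noise as a density on Lebesgue measure\<close>

lemma prob_space_CN: "s > 0 \<Longrightarrow> prob_space (CN s)"
  by (rule prob_spaceI)
     (simp add: CN_def emeasure_density nn_integral_CN_density[simplified])

lemma sets_CN [measurable_cong]: "sets (CN s) = sets borel"
  by (simp add: CN_def)

lemma space_CN [simp]: "space (CN s) = UNIV"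
  by (simp add: CN_def)

lemma AE_CN: "(AE z in lborel. P z) \<Longrightarrow> AE z in CN s. P z"
  unfolding CN_def by (subst AE_density) auto

lemma sets_PiM_CN: "sets (PiM I (\<lambda>_. CN s)) = sets (LC I)"
  by (rule sets_PiM_cong) (auto simp: sets_CN)

lemma sets_noise: "sets (noise k s) = sets (LC {..<k})"
  by (simp add: noise_def sets_PiM_CN)

lemma prob_space_noise: "0 < \<sigma> \<Longrightarrow> prob_space (noise k \<sigma>)"
  unfolding noise_def by (intro prob_space_PiM prob_space_CN)

lemma cnorm2_nonneg: "cnorm2 m x \<ge> 0"
  by (auto simp: cnorm2_def intro: sum_nonneg)

lemma borel_measurable_cnorm2 [measurable]:
  "cnorm2 m \<in> borel_measurable (LC {..<m})"
  unfolding cnorm2_def by measurable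

text \<open>The density factors over the coordinates, and on a finite product it is enough to
  compare measures on boxes. What matters later is that it depends on \<open>z\<close> through
  \<open>cnorm2 m z\<close> alone, so it splits along any orthogonal decomposition.\<close>

lemma noise_eq_density:
  assumes "s > 0"
  shows "noise m s = density (LC {..<m}) (\<lambda>z. ennreal (exp (- cnorm2 m z / s) / (pi * s) ^ m))"
proof -
  interpret CN: prob_space "CN s" by (rule prob_space_CN) fact
  interpret product_sigma_finite "\<lambda>_::nat. CN s" by standard
  have *: "ennreal (exp (- cnorm2 m z / s) / (pi * s) ^ m) =
      (\<Prod>i<m. ennreal (exp (- (cmod (z i))\<^sup>2 / s) / (pi * s)))" for z
    using assms
    by (subst prod_ennreal)
       (auto simp: cnorm2_def exp_sum[symmetric] prod_dividef sum_divide_distrib sum_negf)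
  have "density (LC {..<m}) (\<lambda>z. ennreal (exp (- cnorm2 m z / s) / (pi * s) ^ m)) = noise m s"
    unfolding noise_def
  proof (rule PiM_eqI)
    fix A :: "nat \<Rightarrow> complex set"
    assume A: "\<And>i. i \<in> {..<m} \<Longrightarrow> A i \<in> sets (CN s)"
    then have A' [measurable]: "i < m \<Longrightarrow> A i \<in> sets borel" for i by (auto simp: sets_CN)
    have "Pi\<^sub>E {..<m} A \<in> sets (LC {..<m})"
      by (rule sets_PiM_I_finite) auto
    then have "emeasure (density (LC {..<m}) (\<lambda>z. ennreal (exp (- cnorm2 m z / s) / (pi * s) ^ m))) (Pi\<^sub>E {..<m} A)
       = (\<integral>\<^sup>+z. ennreal (exp (- cnorm2 m z / s) / (pi * s) ^ m) * indicator (Pi\<^sub>E {..<m} A) z \<partial>LC {..<m})"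
      by (subst emeasure_density) auto
    also have "\<dots> = (\<integral>\<^sup>+z. (\<Prod>i<m. ennreal (exp (- (cmod (z i))\<^sup>2 / s) / (pi * s)) * indicator (A i) (z i)) \<partial>LC {..<m})"
    proof (rule nn_integral_cong)
      fix z assume z: "z \<in> space (LC {..<m})"
      have "indicator (Pi\<^sub>E {..<m} A) z = (\<Prod>i<m. indicator (A i) (z i) :: ennreal)"
        using z by (auto simp: indicator_def space_PiM PiE_iff split: if_splits)
      then show "ennreal (exp (- cnorm2 m z / s) / (pi * s) ^ m) * indicator (Pi\<^sub>E {..<m} A) z =
         (\<Prod>i<m. ennreal (exp (- (cmod (z i))\<^sup>2 / s) / (pi * s)) * indicator (A i) (z i))"
        by (simp only: * prod.distrib)
    qed
    also have "\<dots> = (\<Prod>i<m. emeasure (CN s) (A i))"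
      by (subst lborel_pi.product_nn_integral_prod) (auto simp: CN_def emeasure_density intro!: prod.cong)
    finally show "emeasure (density (LC {..<m}) (\<lambda>z. ennreal (exp (- cnorm2 m z / s) / (pi * s) ^ m))) (Pi\<^sub>E {..<m} A)
       = (\<Prod>i\<in>{..<m}. emeasure (CN s) (A i))" .
  qed (auto simp: sets_PiM_CN)
  then show ?thesis by simp
qed

section \<open>Translation and reflection invariance of Lebesgue measure\<close>

lemma distr_LC_componentwise:
  assumes "finite I" and g: "\<And>i. i \<in> I \<Longrightarrow> distr lborel borel (g i) = lborel"
    and [measurable]: "\<And>i. i \<in> I \<Longrightarrow> g i \<in> borel_measurable borel"
  shows "distr (LC I) (LC I) (\<lambda>x. \<lambda>i\<in>I. g i (x i)) = LC I"
\<comment> \<open>Preimages of boxes are boxes, so invariance of each factor is enough. The space of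
  \<open>LC I\<close> consists of extensional functions, which is why the map carries a restriction
  to \<open>I\<close>.\<close>
proof (rule lborel_pi.PiM_eqI)
  fix A :: "'a \<Rightarrow> complex set"
  assume "\<And>i. i \<in> I \<Longrightarrow> A i \<in> sets lborel"
  then have A: "\<And>i. i \<in> I \<Longrightarrow> A i \<in> sets borel" by simp
  have "emeasure (distr (LC I) (LC I) (\<lambda>x. \<lambda>i\<in>I. g i (x i))) (Pi\<^sub>E I A)
     = emeasure (LC I) ((\<lambda>x. \<lambda>i\<in>I. g i (x i)) -` Pi\<^sub>E I A \<inter> space (LC I))"
    using assms(1) A by (intro emeasure_distr sets_PiM_I_finite) auto
  also have "(\<lambda>x. \<lambda>i\<in>I. g i (x i)) -` Pi\<^sub>E I A \<inter> space (LC I) = Pi\<^sub>E I (\<lambda>i. g i -` A i)"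
    by (auto simp: space_PiM PiE_iff)
  also have "emeasure (LC I) \<dots> = (\<Prod>i\<in>I. emeasure lborel (g i -` A i))"
    using assms(1) measurable_sets_borel[OF assms(3) A] by (intro lborel_pi.emeasure_PiM) auto
  also have "\<dots> = (\<Prod>i\<in>I. emeasure lborel (A i))"
  proof (rule prod.cong)
    fix i assume i: "i \<in> I"
    have "emeasure lborel (A i) = emeasure (distr lborel borel (g i)) (A i)"
      using g[OF i] by simp
    also have "\<dots> = emeasure lborel (g i -` A i)"
      using assms(3)[OF i] A[OF i] by (subst emeasure_distr) auto
    finally show "emeasure lborel (g i -` A i) = emeasure lborel (A i)" by simp
  qed simp
  finally show "emeasure (distr (LC I) (LC I) (\<lambda>x. \<lambda>i\<in>I. g i (x i))) (Pi\<^sub>E I A)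
     = (\<Prod>i\<in>I. emeasure lborel (A i))" .
qed (use assms(1) in auto)

lemma nn_integral_LC_translate:
  assumes "finite I" and [measurable]: "f \<in> borel_measurable (LC I)"
  shows "(\<integral>\<^sup>+x. f (\<lambda>i\<in>I. v i + x i) \<partial>LC I) = (\<integral>\<^sup>+x. f x \<partial>LC I)"
proof -
  have "distr (LC I) (LC I) (\<lambda>x. \<lambda>i\<in>I. v i + x i) = LC I"
    using assms(1) by (intro distr_LC_componentwise) (auto simp: lborel_distr_plus[unfolded])
  then have "(\<integral>\<^sup>+x. f x \<partial>LC I) = (\<integral>\<^sup>+x. f x \<partial>distr (LC I) (LC I) (\<lambda>x. \<lambda>i\<in>I. v i + x i))"
    by simp
  also have "\<dots> = (\<integral>\<^sup>+x. f (\<lambda>i\<in>I. v i + x i) \<partial>LC I)"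
    by (rule nn_integral_distr) auto
  finally show ?thesis by simp
qed

lemma lborel_complex_distr_uminus: "distr lborel borel uminus = (lborel :: complex measure)"
  using lborel_distr_mult'[of "-1"] lborel_affine[of "-1" "0::complex"]
  by (simp add: density_1 scaleR_conv_of_real) 

lemma nn_integral_LC_uminus:
  assumes "finite I" and [measurable]: "f \<in> borel_measurable (LC I)"
  shows "(\<integral>\<^sup>+x. f (\<lambda>i\<in>I. - x i) \<partial>LC I) = (\<integral>\<^sup>+x. f x \<partial>LC I)"
proof -
  have "distr (LC I) (LC I) (\<lambda>x. \<lambda>i\<in>I. - x i) = LC I"
    using assms(1) by (intro distr_LC_componentwise) (auto simp: lborel_complex_distr_uminus)
  then have "(\<integral>\<^sup>+x. f x \<partial>LC I) = (\<integral>\<^sup>+x. f x \<partial>distr (LC I) (LC I) (\<lambda>x. \<lambda>i\<in>I. - x i))"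
    by simp
  also have "\<dots> = (\<integral>\<^sup>+x. f (\<lambda>i\<in>I. - x i) \<partial>LC I)"
    by (rule nn_integral_distr) auto
  finally show ?thesis by simp
qed

text \<open>
  The push-forward of the weighted measure \<open>K\<close> under \<open>U\<close> is translation invariant, hence a multiple of
  Lebesgue measure; the constant is eliminated by comparing with a second function \<open>g\<close>. With \<open>U\<close> the
  coordinates of an orthogonal projection this yields the law of projected noise without
  choosing an orthonormal basis.
\<close>

lemma haar_transfer:
  fixes U :: "('i \<Rightarrow> complex) \<Rightarrow> 'j \<Rightarrow> complex"
  assumes I: "finite I" and J: "finite J"
    and [measurable]: "U \<in> LC I \<rightarrow>\<^sub>M LC J" "K \<in> borel_measurable (LC I)"
      "f \<in> borel_measurable (LC J)" "g \<in> borel_measurable (LC J)"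
    and U: "\<And>y z. U (\<lambda>i\<in>I. A y i + z i) = (\<lambda>j\<in>J. y j + U z j)"
    and K: "\<And>y z. K (\<lambda>i\<in>I. A y i + z i) = K z"
  shows "(\<integral>\<^sup>+z. K z * f (U z) \<partial>LC I) * (\<integral>\<^sup>+y. g y \<partial>LC J) =
    (\<integral>\<^sup>+z. K z * g (U z) \<partial>LC I) * (\<integral>\<^sup>+y. f y \<partial>LC J)"
proof -
  interpret I: sigma_finite_measure "LC I" using I by (rule lborel_pi.sigma_finite)
  interpret J: sigma_finite_measure "LC J" using J by (rule lborel_pi.sigma_finite)
  interpret P: pair_sigma_finite "LC I" "LC J" by standard
  have [measurable (raw)]: "(\<lambda>p. U (h p) j) \<in> borel_measurable N"
    if "h \<in> N \<rightarrow>\<^sub>M LC I" "j \<in> J" for h :: "'x \<Rightarrow> 'i \<Rightarrow> complex" and N j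
    using measurable_compose[OF measurable_compose[OF that(1) assms(3)]
        measurable_component_singleton[OF that(2)]] by simp
  have Uz: "(\<lambda>j\<in>J. U z j) = U z" if "z \<in> space (LC I)" for z
    using measurable_space[OF assms(3) that] by (auto simp: space_PiM PiE_iff extensional_restrict)
  have "(\<integral>\<^sup>+z. K z * f (U z) \<partial>LC I) * (\<integral>\<^sup>+y. g y \<partial>LC J)
      = (\<integral>\<^sup>+z. \<integral>\<^sup>+y. K z * f (U z) * g y \<partial>LC J \<partial>LC I)"
    by (simp add: nn_integral_cmult nn_integral_multc)
  \<comment> \<open>For each fixed \<open>z\<close>, translation invariance in \<open>y\<close> lets
    the argument of \<open>g\<close> become \<open>U z + y\<close>.\<close>
  also have "\<dots> = (\<integral>\<^sup>+z. \<integral>\<^sup>+y. K z * f (U z) * g (\<lambda>j\<in>J. U z j + y j) \<partial>LC J \<partial>LC I)"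
  proof (rule nn_integral_cong)
    fix z
    have "(\<integral>\<^sup>+y. K z * f (U z) * g (\<lambda>j\<in>J. U z j + y j) \<partial>LC J) =
        K z * f (U z) * (\<integral>\<^sup>+y. g (\<lambda>j\<in>J. U z j + y j) \<partial>LC J)"
      by (rule nn_integral_cmult) simp
    then show "(\<integral>\<^sup>+y. K z * f (U z) * g y \<partial>LC J) =
        (\<integral>\<^sup>+y. K z * f (U z) * g (\<lambda>j\<in>J. U z j + y j) \<partial>LC J)"
      using J by (simp add: nn_integral_LC_translate nn_integral_cmult)
  qed
  also have "\<dots> = (\<integral>\<^sup>+y. \<integral>\<^sup>+z. K z * f (U z) * g (\<lambda>j\<in>J. U z j + y j) \<partial>LC I \<partial>LC J)"
    by (rule P.Fubini'[symmetric]) simp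
  \<comment> \<open>Read from right to left, this shifts \<open>z\<close> by \<open>A y\<close>:
    \<open>K\<close> stays, \<open>U z\<close> moves by \<open>y\<close>, and so the dependence on
    \<open>y\<close> passes between \<open>f\<close> and \<open>g\<close>.\<close>
  also have "\<dots> = (\<integral>\<^sup>+y. \<integral>\<^sup>+z. K z * f (\<lambda>j\<in>J. - y j + U z j) * g (U z) \<partial>LC I \<partial>LC J)"
  proof (rule nn_integral_cong)
    fix y assume y: "y \<in> space (LC J)"
    have "(\<integral>\<^sup>+z. K z * f (\<lambda>j\<in>J. - y j + U z j) * g (U z) \<partial>LC I) =
      (\<integral>\<^sup>+z. K (\<lambda>i\<in>I. A y i + z i) * f (\<lambda>j\<in>J. - y j + U (\<lambda>i\<in>I. A y i + z i) j)
         * g (U (\<lambda>i\<in>I. A y i + z i)) \<partial>LC I)"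
      using I y by (subst nn_integral_LC_translate) auto
    also have "\<dots> = (\<integral>\<^sup>+z. K z * f (U z) * g (\<lambda>j\<in>J. U z j + y j) \<partial>LC I)"
    proof (rule nn_integral_cong)
      fix z assume z: "z \<in> space (LC I)"
      have "(\<lambda>j\<in>J. - y j + (\<lambda>j\<in>J. y j + U z j) j) = U z"
        by (subst Uz[OF z, symmetric]) (auto simp: restrict_def)
      then show "K (\<lambda>i\<in>I. A y i + z i) * f (\<lambda>j\<in>J. - y j + U (\<lambda>i\<in>I. A y i + z i) j)
         * g (U (\<lambda>i\<in>I. A y i + z i)) = K z * f (U z) * g (\<lambda>j\<in>J. U z j + y j)"
        unfolding U K by (simp only: add.commute)
    qed
    finally show "(\<integral>\<^sup>+z. K z * f (U z) * g (\<lambda>j\<in>J. U z j + y j) \<partial>LC I) =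
      (\<integral>\<^sup>+z. K z * f (\<lambda>j\<in>J. - y j + U z j) * g (U z) \<partial>LC I)" by simp
  qed
  also have "\<dots> = (\<integral>\<^sup>+z. \<integral>\<^sup>+y. K z * f (\<lambda>j\<in>J. - y j + U z j) * g (U z) \<partial>LC J \<partial>LC I)"
    by (rule P.Fubini') simp
  \<comment> \<open>Reflecting and translating \<open>y\<close> frees \<open>f\<close> of
    \<open>U z\<close>, and the two integrals separate.\<close>
  also have "\<dots> = (\<integral>\<^sup>+z. K z * g (U z) * (\<integral>\<^sup>+y. f y \<partial>LC J) \<partial>LC I)"
  proof (rule nn_integral_cong)
    fix z
    have "(\<integral>\<^sup>+y. f (\<lambda>j\<in>J. - y j + U z j) \<partial>LC J) = (\<integral>\<^sup>+y. f (\<lambda>j\<in>J. U z j + (\<lambda>j\<in>J. - y j) j) \<partial>LC J)"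
      by (simp add: restrict_def add.commute cong: if_cong)
    also have "\<dots> = (\<integral>\<^sup>+y. f (\<lambda>j\<in>J. U z j + y j) \<partial>LC J)"
      using J by (rule nn_integral_LC_uminus) simp
    also have "\<dots> = (\<integral>\<^sup>+y. f y \<partial>LC J)"
      using J by (rule nn_integral_LC_translate) simp
    finally have *: "(\<integral>\<^sup>+y. f (\<lambda>j\<in>J. - y j + U z j) \<partial>LC J) = (\<integral>\<^sup>+y. f y \<partial>LC J)" .
    have "(\<integral>\<^sup>+y. K z * f (\<lambda>j\<in>J. - y j + U z j) * g (U z) \<partial>LC J) =
      (\<integral>\<^sup>+y. K z * g (U z) * f (\<lambda>j\<in>J. - y j + U z j) \<partial>LC J)"
      by (simp add: ac_simps)
    also have "\<dots> = K z * g (U z) * (\<integral>\<^sup>+y. f (\<lambda>j\<in>J. - y j + U z j) \<partial>LC J)"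
      by (rule nn_integral_cmult) simp
    finally show "(\<integral>\<^sup>+y. K z * f (\<lambda>j\<in>J. - y j + U z j) * g (U z) \<partial>LC J) =
      K z * g (U z) * (\<integral>\<^sup>+y. f y \<partial>LC J)" unfolding * .
  qed
  also have "\<dots> = (\<integral>\<^sup>+z. K z * g (U z) \<partial>LC I) * (\<integral>\<^sup>+y. f y \<partial>LC J)"
    by (rule nn_integral_multc) simp
  finally show ?thesis .
qed

section \<open>Hermitian forms\<close>

lemma cdet_eq_det: "cdet m A = det (mat m m (\<lambda>(i, j). A i j))"
proof -
  have "(\<Prod>i<m. A i (p i)) = (\<Prod>i=0..<m. mat m m (\<lambda>(i, j). A i j) $$ (i, p i))"
    if "p permutes {..<m}" for p
    using permutes_in_image[OF that]
    by (intro prod.cong) (auto simp: atLeast0LessThan)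
  then show ?thesis
    unfolding cdet_def det_def by (auto simp: atLeast0LessThan sign_def intro!: sum.cong)
qed

text \<open>Block elimination: \<open>?E\<close> is unipotent and \<open>?T\<close> is block
  triangular, so only the pivot and the Schur complement contribute. The pivot is the last index to
  fit the recursion over \<open>{..<l}\<close>.\<close>

lemma cdet_Schur:
  assumes "G l l \<noteq> 0"
  shows "cdet (Suc l) G = G l l * cdet l (\<lambda>i j. G i j - G i l * G l j / G l l)"
proof -
  let ?G' = "mat l l (\<lambda>(i, j). G i j - G i l * G l j / G l l)"
  let ?E = "four_block_mat (1\<^sub>m l) (mat l 1 (\<lambda>(i, j). G i l / G l l)) (0\<^sub>m 1 l) (1\<^sub>m 1)"
  let ?T = "four_block_mat ?G' (0\<^sub>m l 1) (mat 1 l (\<lambda>(i, j). G l j)) (mat 1 1 (\<lambda>_. G l l))"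
  have "mat (Suc l) (Suc l) (\<lambda>(i, j). G i j) = ?E * ?T"
  proof (subst mult_four_block_mat, goal_cases)
    case 9
    show ?case
    proof (rule eq_matI, goal_cases)
      case (1 i j)
      then show ?case using assms
        by (auto simp: scalar_prod_def less_Suc_eq)
    qed auto
  qed auto
  moreover have "det ?E = 1"
    by (subst det_four_block_mat_lower_left_zero[where n = l and m = 1]) auto
  moreover have "det ?T = det ?G' * G l l"
    by (subst det_four_block_mat_upper_right_zero[where n = l and m = 1])
       (auto simp: det_single)
  moreover have "det (?E * ?T) = det ?E * det ?T"
    by (rule det_mult[of _ "l + 1"]) auto
  ultimately show ?thesis
    by (simp add: cdet_eq_det)
qed

lemma borel_measurable_cnj [measurable]: "cnj \<in> borel_measurable borel"
  by (intro borel_measurable_continuous_onI continuous_intros)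

text \<open>For a Hermitian \<open>G\<close> the double sum is already real; \<open>Re\<close>
  merely changes its type.\<close>

definition qform :: "nat \<Rightarrow> (nat \<Rightarrow> nat \<Rightarrow> complex) \<Rightarrow> (nat \<Rightarrow> complex) \<Rightarrow> real" where
  "qform l G x = Re (\<Sum>i<l. \<Sum>j<l. cnj (x i) * G i j * x j)"

lemma borel_measurable_qform [measurable]: "qform l G \<in> borel_measurable (LC {..<l})"
  unfolding qform_def by measurable

text \<open>Vectors are functions with arbitrary values beyond \<open>l\<close>, so being nonzero
  means being nonzero at an index below \<open>l\<close>.\<close>

definition hermitian_pd :: "nat \<Rightarrow> (nat \<Rightarrow> nat \<Rightarrow> complex) \<Rightarrow> bool" where
  "hermitian_pd l G \<longleftrightarrow> (\<forall>i<l. \<forall>j<l. G i j = cnj (G j i)) \<and>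
     (\<forall>x. (\<exists>i<l. x i \<noteq> 0) \<longrightarrow> qform l G x > 0)"

text \<open>Completing the square in the last coordinate. What remains is the form of the Schur
  complement, the same matrix that \<open>cdet_Schur\<close> leaves behind.\<close>

lemma qform_Suc:
  assumes "\<And>i j. i \<le> l \<Longrightarrow> j \<le> l \<Longrightarrow> G i j = cnj (G j i)" and "G l l = of_real g" "g > 0"
  shows "qform (Suc l) G x = g * (cmod ((\<Sum>j<l. G l j * x j / g) + x l))\<^sup>2 +
    qform l (\<lambda>i j. G i j - G i l * G l j / G l l) x"
proof -
  let ?b = "\<Sum>j<l. G l j * x j"
  have b: "(\<Sum>i<l. cnj (x i) * G i l) = cnj ?b"
    unfolding cnj_sum complex_cnj_mult
    by (intro sum.cong) (auto simp: assms(1)[of _ l])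
  have "(\<Sum>i<Suc l. \<Sum>j<Suc l. cnj (x i) * G i j * x j) =
    (\<Sum>i<l. \<Sum>j<l. cnj (x i) * G i j * x j) + (\<Sum>i<l. cnj (x i) * G i l) * x l
      + cnj (x l) * ?b + cnj (x l) * G l l * x l"
    by (simp add: sum.distrib sum_distrib_right sum_distrib_left mult.assoc)
  also have "(\<Sum>i<l. \<Sum>j<l. cnj (x i) * G i j * x j) =
     (\<Sum>i<l. \<Sum>j<l. cnj (x i) * (G i j - G i l * G l j / G l l) * x j)
       + (\<Sum>i<l. cnj (x i) * G i l) * ?b / g"
    unfolding sum_product sum_divide_distrib sum.distrib[symmetric] assms(2)
    by (intro sum.cong) (auto simp: algebra_simps)
  finally have "(\<Sum>i<Suc l. \<Sum>j<Suc l. cnj (x i) * G i j * x j) =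
    (\<Sum>i<l. \<Sum>j<l. cnj (x i) * (G i j - G i l * G l j / G l l) * x j) +
    (cnj ?b * ?b / g + cnj ?b * x l + cnj (x l) * ?b + cnj (x l) * g * x l)"
    unfolding b assms(2) by (simp only: add_ac)
  then have "qform (Suc l) G x = qform l (\<lambda>i j. G i j - G i l * G l j / G l l) x +
    Re (cnj ?b * ?b / g + cnj ?b * x l + cnj (x l) * ?b + cnj (x l) * g * x l)"
    unfolding qform_def by (simp only: plus_complex.sel)
  also have "cnj ?b * ?b / g + cnj ?b * x l + cnj (x l) * ?b + cnj (x l) * g * x l =
     g * ((?b / g + x l) * cnj (?b / g + x l))"
    using assms(3) by (simp add: field_simps power2_eq_square)
  also have "\<dots> = of_real (g * (cmod (?b / g + x l))\<^sup>2)"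
    by (subst complex_norm_square[symmetric]) simp
  finally show ?thesis by (simp add: sum_divide_distrib add.commute)
qed

text \<open>Induction on the dimension: completing the square and rescaling the last coordinate
  costs \<open>1 / g\<close>, where \<open>g\<close> is the pivot, and the induction hypothesis
  handles the Schur complement. The product of the pivots is the determinant. The shift inside the
  square disappears when the last coordinate is integrated out.\<close>

lemma nn_integral_qform:
  assumes "hermitian_pd l G"
  shows "\<exists>d>0. cdet l G = of_real d \<and> (\<forall>f\<in>borel_measurable borel.
    (\<integral>\<^sup>+u. f (qform l G u) \<partial>LC {..<l}) = ennreal (1 / d) * (\<integral>\<^sup>+u. f (cnorm2 l u) \<partial>LC {..<l}))"
  using assms
proof (induction l arbitrary: G)
  case 0
  show ?case
    by (intro exI[of _ 1]) (auto simp: cdet_eq_det qform_def cnorm2_def)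
next
  case (Suc l)
  have herm: "G i j = cnj (G j i)" if "i \<le> l" "j \<le> l" for i j
    using Suc.prems that unfolding hermitian_pd_def by (meson le_imp_less_Suc)
  have pos: "qform (Suc l) G x > 0" if "x i \<noteq> 0" "i \<le> l" for x i
    using Suc.prems that unfolding hermitian_pd_def by (meson le_imp_less_Suc)
  define g where "g = Re (G l l)"
  have g: "G l l = of_real g"
    using herm[of l l] by (auto simp: complex_eq_iff g_def)
  \<comment> \<open>Testing the form at the last unit vector isolates the pivot and shows that it is
    positive.\<close>
  have "qform (Suc l) G (\<lambda>i. if i = l then 1 else 0) = g"
    by (simp add: qform_def g_def cong: sum.cong_simp)
  with pos[of "\<lambda>i. if i = l then 1 else 0" l] have g0: "g > 0" by simp
  define G' where "G' = (\<lambda>i j. G i j - G i l * G l j / G l l)"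
  have qf: "qform (Suc l) G x = g * (cmod ((\<Sum>j<l. G l j * x j / g) + x l))\<^sup>2 + qform l G' x" for x
    unfolding G'_def using herm g g0 by (intro qform_Suc)
  have pd: "hermitian_pd l G'"
    unfolding hermitian_pd_def
  proof safe
    fix i j assume "i < l" "j < l"
    then show "G' i j = cnj (G' j i)"
      using herm[of i j] herm[of i l] herm[of l j]
      by (simp add: G'_def g mult.commute)
  next
    fix x :: "nat \<Rightarrow> complex" and i assume i: "i < l" "x i \<noteq> 0"
    \<comment> \<open>The last coordinate is chosen to make the completed square vanish, so
      positivity passes to the Schur complement.\<close>
    define x' where "x' = x(l := - (\<Sum>j<l. G l j * x j / g))"
    have "qform (Suc l) G x' = qform l G' x'"
      unfolding qf by (simp add: x'_def)
    also have "\<dots> = qform l G' x" by (simp add: qform_def x'_def)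
    finally show "qform l G' x > 0"
      using pos[of x' i] i by (auto simp: x'_def)
  qed
  obtain d where d: "d > 0" "cdet l G' = of_real d" and int: "\<And>f. f \<in> borel_measurable borel \<Longrightarrow>
    (\<integral>\<^sup>+u. f (qform l G' u) \<partial>LC {..<l}) = ennreal (1 / d) * (\<integral>\<^sup>+u. f (cnorm2 l u) \<partial>LC {..<l})"
    using Suc.IH[OF pd] by blast
  show ?case
  proof (intro exI[of _ "g * d"] conjI ballI)
    show "g * d > 0" using g0 d by simp
    show "cdet (Suc l) G = of_real (g * d)"
      using g0 d by (simp add: cdet_Schur g G'_def)
    fix f :: "real \<Rightarrow> ennreal" assume [measurable]: "f \<in> borel_measurable borel"
    interpret L: sigma_finite_measure "LC {..<l}" by (rule lborel_pi.sigma_finite) simp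
    interpret P: pair_sigma_finite "LC {..<l}" "lborel :: complex measure" by standard
    have [measurable]: "qform (Suc l) G \<in> borel_measurable (LC (insert l {..<l}))"
      "cnorm2 (Suc l) \<in> borel_measurable (LC (insert l {..<l}))"
      by (simp_all flip: lessThan_Suc)
    \<comment> \<open>The last coordinate is moved outermost because the induction hypothesis will
      be applied, for each fixed \<open>y\<close>, to \<open>f\<close> shifted by
      \<open>(cmod y)\<^sup>2\<close>.\<close>
    have "(\<integral>\<^sup>+u. f (cnorm2 (Suc l) u) \<partial>LC {..<Suc l}) =
       (\<integral>\<^sup>+u. \<integral>\<^sup>+y. f (cnorm2 (Suc l) (u(l := y))) \<partial>lborel \<partial>LC {..<l})"
      unfolding lessThan_Suc
      by (rule lborel_pi.product_nn_integral_insert[OF finite_lessThan]) (simp, measurable)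
    also have "\<dots> = (\<integral>\<^sup>+u. \<integral>\<^sup>+y. f ((cmod y)\<^sup>2 + cnorm2 l u) \<partial>lborel \<partial>LC {..<l})"
      by (simp add: cnorm2_def add.commute)
    also have "\<dots> = (\<integral>\<^sup>+y. \<integral>\<^sup>+u. f ((cmod y)\<^sup>2 + cnorm2 l u) \<partial>LC {..<l} \<partial>lborel)"
      by (rule P.Fubini'[symmetric]) simp
    finally have swap: "(\<integral>\<^sup>+u. f (cnorm2 (Suc l) u) \<partial>LC {..<Suc l}) = \<dots>" .
    have "(\<integral>\<^sup>+u. f (qform (Suc l) G u) \<partial>LC {..<Suc l}) =
      (\<integral>\<^sup>+u. \<integral>\<^sup>+y. f (qform (Suc l) G (u(l := y))) \<partial>lborel \<partial>LC {..<l})"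
      unfolding lessThan_Suc by (subst lborel_pi.product_nn_integral_insert) auto
    also have "\<dots> = (\<integral>\<^sup>+u. \<integral>\<^sup>+y. ennreal (1 / g) * f ((cmod y)\<^sup>2 + qform l G' u) \<partial>lborel \<partial>LC {..<l})"
    proof (rule nn_integral_cong)
      fix u
      let ?b = "\<Sum>j<l. G l j * u j / g"
      \<comment> \<open>The root of the pivot is absorbed into the square, which leaves an affine
        substitution in \<open>y\<close>.\<close>
      have "(\<integral>\<^sup>+y. f (qform (Suc l) G (u(l := y))) \<partial>lborel) =
        (\<integral>\<^sup>+y. f ((cmod (sqrt g * ?b + of_real (sqrt g) * y))\<^sup>2 + qform l G' u) \<partial>lborel)"
      proof (rule nn_integral_cong)
        fix y :: complex
        have "qform l G' (u(l := y)) = qform l G' u" by (simp add: qform_def)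
        moreover have "(cmod (sqrt g * ?b + sqrt g * y))\<^sup>2 = g * (cmod (?b + y))\<^sup>2"
          using g0 by (simp add: norm_mult power_mult_distrib flip: distrib_left)
        ultimately show "f (qform (Suc l) G (u(l := y))) =
          f ((cmod (sqrt g * ?b + sqrt g * y))\<^sup>2 + qform l G' u)"
          unfolding qf by simp
      qed
      also have "\<dots> = ennreal (1 / g) * (\<integral>\<^sup>+y. f ((cmod y)\<^sup>2 + qform l G' u) \<partial>lborel)"
        using g0 by (subst nn_integral_complex_scale[of "\<lambda>y. f ((cmod y)\<^sup>2 + qform l G' u)"]) auto
      also have "\<dots> = (\<integral>\<^sup>+y. ennreal (1 / g) * f ((cmod y)\<^sup>2 + qform l G' u) \<partial>lborel)"
        by (rule nn_integral_cmult[symmetric]) simp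
      finally show "(\<integral>\<^sup>+y. f (qform (Suc l) G (u(l := y))) \<partial>lborel) = \<dots>" .
    qed
    also have "\<dots> = (\<integral>\<^sup>+y. \<integral>\<^sup>+u. ennreal (1 / g) * f ((cmod y)\<^sup>2 + qform l G' u) \<partial>LC {..<l} \<partial>lborel)"
      by (rule P.Fubini'[symmetric]) simp
    also have "\<dots> = (\<integral>\<^sup>+y. ennreal (1 / g) * (ennreal (1 / d) * (\<integral>\<^sup>+u. f ((cmod y)\<^sup>2 + cnorm2 l u) \<partial>LC {..<l})) \<partial>lborel)"
    proof (rule nn_integral_cong)
      fix y :: complex
      have "(\<integral>\<^sup>+u. ennreal (1 / g) * f ((cmod y)\<^sup>2 + qform l G' u) \<partial>LC {..<l}) =
          ennreal (1 / g) * (\<integral>\<^sup>+u. f ((cmod y)\<^sup>2 + qform l G' u) \<partial>LC {..<l})"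
        by (rule nn_integral_cmult) simp
      then show "(\<integral>\<^sup>+u. ennreal (1 / g) * f ((cmod y)\<^sup>2 + qform l G' u) \<partial>LC {..<l}) =
         ennreal (1 / g) * (ennreal (1 / d) * (\<integral>\<^sup>+u. f ((cmod y)\<^sup>2 + cnorm2 l u) \<partial>LC {..<l}))"
        by (simp add: int[of "\<lambda>x. f ((cmod y)\<^sup>2 + x)"])
    qed
    also have "\<dots> = ennreal (1 / (g * d)) * (\<integral>\<^sup>+y. \<integral>\<^sup>+u. f ((cmod y)\<^sup>2 + cnorm2 l u) \<partial>LC {..<l} \<partial>lborel)"
    proof -
      have "ennreal (1 / (g * d)) = ennreal (1 / g) * ennreal (1 / d)"
        using g0 d by (simp flip: ennreal_mult)
      then have "ennreal (1 / g) * (ennreal (1 / d) * x) = ennreal (1 / (g * d)) * x" for x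
        by (simp only: mult.assoc)
      then show ?thesis
        by (simp only:) (rule nn_integral_cmult, simp)
    qed
    also have "\<dots> = ennreal (1 / (g * d)) * (\<integral>\<^sup>+u. f (cnorm2 (Suc l) u) \<partial>LC {..<Suc l})"
      unfolding swap ..
    finally show "(\<integral>\<^sup>+u. f (qform (Suc l) G u) \<partial>LC {..<Suc l}) =
      ennreal (1 / (g * d)) * (\<integral>\<^sup>+u. f (cnorm2 (Suc l) u) \<partial>LC {..<Suc l})" .
  qed
qed

section \<open>Volumes and null sets\<close>

lemma nn_integral_gaussian_LC:
  assumes "s > 0"
  shows "(\<integral>\<^sup>+u. ennreal (exp (- cnorm2 l u / s)) \<partial>LC {..<l}) = ennreal ((pi * s) ^ l)"
proof -
  have "ennreal (exp (- cnorm2 l u / s)) = (\<Prod>i<l. ennreal (exp (- (cmod (u i))\<^sup>2 / s)))" for u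
    by (subst prod_ennreal)
       (auto simp: cnorm2_def exp_sum[symmetric] sum_divide_distrib sum_negf)
  then have "(\<integral>\<^sup>+u. ennreal (exp (- cnorm2 l u / s)) \<partial>LC {..<l}) =
      (\<Prod>i<l. (\<integral>\<^sup>+z. ennreal (exp (- (cmod z)\<^sup>2 / s)) \<partial>lborel))"
    by (simp only:, subst lborel_pi.product_nn_integral_prod) auto
  also have "\<dots> = ennreal ((pi * s) ^ l)"
    using assms unfolding nn_integral_gaussian_complex[OF assms] by (simp add: ennreal_power)
  finally show ?thesis .
qed

text \<open>Feeding this matrix to \<open>nn_integral_qform\<close> shows how volumes scale under
  dilations of C^l.\<close>

lemma hermitian_pd_scalar:
  assumes "c > 0"
  shows "hermitian_pd l (\<lambda>i j. if i = j then of_real c else 0)"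
    and "qform l (\<lambda>i j. if i = j then of_real c else 0) x = c * cnorm2 l x"
    and "cdet l (\<lambda>i j. if i = j then of_real c else 0) = of_real (c ^ l)"
proof -
  have q: "qform l (\<lambda>i j. if i = j then of_real c else 0) x = c * cnorm2 l x" for x
  proof -
    have "cnj (x i) * (if i = j then of_real c else 0) * x j =
        (if j = i then of_real (c * (cmod (x i))\<^sup>2) else 0)" for i j
      using complex_norm_square[of "x i"] by simp
    then show ?thesis
      unfolding qform_def cnorm2_def by (simp only:) (simp add: sum_distrib_left)
  qed
  show "qform l (\<lambda>i j. if i = j then of_real c else 0) x = c * cnorm2 l x" by (rule q)
  have "cnorm2 l x > 0" if "i < l" "x i \<noteq> 0" for x i
    unfolding cnorm2_def by (rule sum_pos2[of _ i]) (use that in auto)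
  then show "hermitian_pd l (\<lambda>i j. if i = j then of_real c else 0)"
    using assms unfolding hermitian_pd_def q by auto
  have "mat l l (\<lambda>(i, j). if i = j then complex_of_real c else 0) = of_real c \<cdot>\<^sub>m 1\<^sub>m l"
    by (rule eq_matI) auto
  then show "cdet l (\<lambda>i j. if i = j then of_real c else 0) = of_real (c ^ l)"
    by (simp add: cdet_eq_det)
qed

text \<open>The volume \<open>V y\<close> is homogeneous of degree \<open>l\<close> in the squared
  radius. Its constant comes from computing the Gaussian integral \<open>pi ^ l\<close> a second
  time by layers: it equals \<open>V 1\<close> times the integral of
  \<open>y ^ l * exp (- y)\<close>, which is \<open>fact l\<close>.\<close>

lemma emeasure_cnorm2_less:
  assumes "y > 0"
  shows "emeasure (LC {..<l}) {u \<in> space (LC {..<l}). cnorm2 l u < y} = ennreal (pi ^ l / fact l * y ^ l)"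
proof -
  interpret L: sigma_finite_measure "LC {..<l}" by (rule lborel_pi.sigma_finite) simp
  define V where "V = (\<lambda>y. emeasure (LC {..<l}) {u \<in> space (LC {..<l}). cnorm2 l u < y})"
  have V: "V y = (\<integral>\<^sup>+u. indicator {..<y} (cnorm2 l u) \<partial>LC {..<l})" for y
  proof -
    have "V y = (\<integral>\<^sup>+u. indicator {u \<in> space (LC {..<l}). cnorm2 l u < y} u \<partial>LC {..<l})"
      unfolding V_def by (rule nn_integral_indicator[symmetric]) simp
    also have "\<dots> = (\<integral>\<^sup>+u. indicator {..<y} (cnorm2 l u) \<partial>LC {..<l})"
      by (rule nn_integral_cong) (simp split: split_indicator)
    finally show ?thesis .
  qed
  have scale: "V y = ennreal (y ^ l) * V 1" if "y > 0" for y
  proof -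
    \<comment> \<open>The squared norm multiplied by \<open>1 / y\<close> is below 1 exactly on the
      ball of squared radius \<open>y\<close>.\<close>
    have "1 / y > 0" using that by simp
    note G = hermitian_pd_scalar[OF this]
    obtain d where d: "cdet l (\<lambda>i j. if i = j then of_real (1 / y) else 0) = of_real d"
      and int: "\<forall>f\<in>borel_measurable borel.
        (\<integral>\<^sup>+u. f (qform l (\<lambda>i j. if i = j then of_real (1 / y) else 0) u) \<partial>LC {..<l}) =
        ennreal (1 / d) * (\<integral>\<^sup>+u. f (cnorm2 l u) \<partial>LC {..<l})"
      using nn_integral_qform[OF G(1)] by blast
    note int = int[unfolded G(2), rule_format]
    have "d = (1 / y) ^ l" using d[unfolded G(3)] by (simp only: of_real_eq_iff)
    moreover have "(\<lambda>u. indicator {..<1} (1 / y * cnorm2 l u) :: ennreal) = (\<lambda>u. indicator {..<y} (cnorm2 l u))"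
      using that by (auto simp: fun_eq_iff indicator_def field_simps)
    moreover have "ennreal (1 / (1 / y) ^ l) = ennreal (y ^ l)"
      by (simp add: power_one_over)
    ultimately show ?thesis
      unfolding V using int[of "indicator {..<1}"] by (simp only: borel_measurable_indicator borel_open open_lessThan)
  qed
  have "ennreal (pi ^ l) = (\<integral>\<^sup>+u. ennreal (exp (- cnorm2 l u)) \<partial>LC {..<l})"
    using nn_integral_gaussian_LC[of 1 l] by simp
  also have "\<dots> = (\<integral>\<^sup>+y. ennreal (exp (- y)) * indicator {0..} y * V y \<partial>lborel)"
    unfolding V_def by (rule nn_integral_layer_cake)
      (auto intro: L.sigma_finite_measure_axioms cnorm2_nonneg)
  also have "\<dots> = (\<integral>\<^sup>+y. V 1 * (ennreal (y ^ l * exp (- y)) * indicator {0..} y) \<partial>lborel)"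
  \<comment> \<open>Homogeneity is available for \<open>y > 0\<close> only; the point 0 is discarded
    as a null set.\<close>
  proof (rule nn_integral_cong_AE, use AE_lborel_singleton[of 0] in eventually_elim)
    fix y :: real assume "y \<noteq> 0"
    then show "ennreal (exp (- y)) * indicator {0..} y * V y =
        V 1 * (ennreal (y ^ l * exp (- y)) * indicator {0..} y)"
      using scale[of y] by (auto simp: ennreal_mult' ac_simps split: split_indicator)
  qed
  also have "\<dots> = V 1 * ennreal (fact l)"
    by (subst nn_integral_cmult) (auto simp: nn_intergal_power_times_exp_Ici)
  finally have *: "ennreal (pi ^ l) = V 1 * ennreal (fact l)" .
  have "ennreal (pi ^ l / fact l) = ennreal (pi ^ l) * ennreal (1 / fact l)"
    by (subst ennreal_mult'[symmetric]) auto
  also have "\<dots> = V 1 * (ennreal (fact l) * ennreal (1 / fact l))"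
    unfolding * by (rule mult.assoc)
  also have "ennreal (fact l) * ennreal (1 / fact l) = 1"
    by (subst ennreal_mult'[symmetric]) auto
  finally have V1: "V 1 = ennreal (pi ^ l / fact l)" by simp
  have "V y = ennreal (y ^ l * (pi ^ l / fact l))"
    unfolding scale[OF assms] V1 using assms by (intro ennreal_mult'[symmetric]) simp
  then show ?thesis
    unfolding V_def by (simp only: mult.commute)
qed

section \<open>Null hyperplanes and cubes\<close>

lemma AE_complex_hyperplane:
  assumes "w \<noteq> 0"
  shows "AE y in lborel. Re (w * y) \<noteq> c"
proof -

  have "{y. Re (w * y) = c} = {y. inner (cnj w) y = c}"
    by (simp add: inner_complex_def)
  moreover have "negligible {y. inner (cnj w) y = c}"
    using assms by (intro negligible_hyperplane) auto
  ultimately have "{y. Re (w * y) = c} \<in> null_sets lebesgue"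
    by (simp add: negligible_iff_null_sets)
  then have "{y. Re (w * y) = c} \<in> null_sets lborel"
    by (subst (asm) null_sets_completion_iff) auto
  then show ?thesis
    by (rule AE_I') auto
qed

text \<open>Tonelli with coordinate \<open>i\<close> as the inner variable: when the others are
  fixed, the excluded values of \<open>u i\<close> form a line in the plane.\<close>

lemma AE_LC_hyperplane:
  assumes "finite I" "i \<in> I" "w i \<noteq> 0"
  shows "AE u in LC I. Re (\<Sum>j\<in>I. w j * u j) \<noteq> c"
proof -
  define J where "J = I - {i}"
  have I: "I = insert i J" "finite J" "i \<notin> J" using assms by (auto simp: J_def)
  let ?f = "\<lambda>u. indicator {x::real. x = c} (Re (\<Sum>j\<in>insert i J. w j * u j)) :: ennreal"
  have "(\<integral>\<^sup>+u. ?f u \<partial>LC (insert i J)) = (\<integral>\<^sup>+u. \<integral>\<^sup>+y. ?f (u(i := y)) \<partial>lborel \<partial>LC J)"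
    using I by (intro lborel_pi.product_nn_integral_insert) auto
  also have "\<dots> = (\<integral>\<^sup>+u. 0 \<partial>LC J)"
  proof (rule nn_integral_cong)
    fix u
    have eq: "(\<Sum>j\<in>insert i J. w j * (u(i := y)) j) = w i * y + (\<Sum>j\<in>J. w j * u j)" for y
      using I by (auto intro!: sum.cong)
    show "(\<integral>\<^sup>+y. ?f (u(i := y)) \<partial>lborel) = 0"
      unfolding eq
      by (subst nn_integral_0_iff_AE, simp)
         (use AE_complex_hyperplane[OF assms(3), of "c - Re (\<Sum>j\<in>J. w j * u j)"] in
           \<open>eventually_elim, auto split: split_indicator\<close>)
  qed
  finally have "AE u in LC (insert i J). ?f u = 0"
    by (subst nn_integral_0_iff_AE[symmetric]) auto
  then show ?thesis
    unfolding I(1)[symmetric] by eventually_elim (auto split: split_indicator_asm)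
qed

text \<open>Counterpart of \<open>Cb\<close> inside the space of \<open>LC {..<l}\<close>, whose
  elements are \<open>undefined\<close> rather than 0 outside the index set; \<open>b\<close> is
  half the side length.\<close>

definition cube :: "nat \<Rightarrow> real \<Rightarrow> (nat \<Rightarrow> complex) set" where
  "cube l b = {u \<in> space (LC {..<l}). \<forall>i<l. \<bar>Re (u i)\<bar> < b \<and> \<bar>Im (u i)\<bar> < b}"

lemma sets_cube [measurable]: "cube l b \<in> sets (LC {..<l})"
  unfolding cube_def by measurable

lemma emeasure_cube:
  assumes "b > 0"
  shows "emeasure (LC {..<l}) (cube l b) = ennreal ((2 * b) ^ (2 * l))"
proof -
  have "z \<in> box (Complex (-b) (-b)) (Complex b b) \<longleftrightarrow> \<bar>Re z\<bar> < b \<and> \<bar>Im z\<bar> < b" for z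
    unfolding mem_box Basis_complex_def by (simp add: inner_complex_def) linarith
  then have "cube l b = Pi\<^sub>E {..<l} (\<lambda>_. box (Complex (-b) (-b)) (Complex b b))"
    by (auto simp: set_eq_iff cube_def space_PiM PiE_iff)
  moreover have "emeasure lborel (box (Complex (-b) (-b)) (Complex b b)) = ennreal ((2 * b)\<^sup>2)"
    using assms by (subst emeasure_lborel_box) (auto simp: Basis_complex_def power2_eq_square)
  ultimately show ?thesis
    by (simp add: lborel_pi.emeasure_PiM ennreal_power power_mult)
qed

section \<open>Projected noise and Voronoi cells\<close>

definition mat_app :: "nat \<Rightarrow> (nat \<Rightarrow> nat \<Rightarrow> complex) \<Rightarrow> (nat \<Rightarrow> complex) \<Rightarrow> nat \<Rightarrow> complex" where
  "mat_app l A x c = (\<Sum>a<l. A c a * x a)"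

definition gram :: "nat \<Rightarrow> (nat \<Rightarrow> nat \<Rightarrow> complex) \<Rightarrow> nat \<Rightarrow> nat \<Rightarrow> complex" where
  "gram m A a b = (\<Sum>c<m. cnj (A c a) * A c b)"

lemma mat_app_add: "mat_app l A (\<lambda>i. x i + y i) c = mat_app l A x c + mat_app l A y c"
  by (simp add: mat_app_def sum.distrib distrib_left)

lemma mat_app_diff: "mat_app l A (\<lambda>i. x i - y i) c = mat_app l A x c - mat_app l A y c"
  by (simp add: mat_app_def sum_subtractf right_diff_distrib)

lemma mat_app_cong: "(\<And>i. i < l \<Longrightarrow> x i = y i) \<Longrightarrow> mat_app l A x = mat_app l A y"
  by (auto simp: mat_app_def fun_eq_iff intro!: sum.cong)

lemma cnorm2_cong: "(\<And>i. i < m \<Longrightarrow> x i = y i) \<Longrightarrow> cnorm2 m x = cnorm2 m y"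
  by (simp add: cnorm2_def)

lemma borel_measurable_mat_app [measurable]:
  "(\<lambda>x. mat_app l A x c) \<in> borel_measurable (LC {..<l})"
  unfolding mat_app_def by measurable

lemma cnorm2_add:
  "cnorm2 m (\<lambda>c. x c + y c) = cnorm2 m x + cnorm2 m y + 2 * Re (\<Sum>c<m. cnj (y c) * x c)"
proof -
  have "(cmod (x c + y c))\<^sup>2 = (cmod (x c))\<^sup>2 + (cmod (y c))\<^sup>2 + 2 * Re (cnj (y c) * x c)" for c
    unfolding cmod_power2 by (simp add: power2_eq_square algebra_simps)
  then show ?thesis
    by (simp only: cnorm2_def sum.distrib Re_sum sum_distrib_left)
qed

lemma sum_cnj_mat_app:
  "(\<Sum>c<m. cnj (mat_app l A w c) * x c) = (\<Sum>a<l. cnj (w a) * (\<Sum>c<m. cnj (A c a) * x c))"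
proof -
  have "(\<Sum>c<m. cnj (mat_app l A w c) * x c) = (\<Sum>c<m. \<Sum>a<l. cnj (w a) * (cnj (A c a) * x c))"
    by (simp add: mat_app_def sum_distrib_left sum_distrib_right ac_simps)
  also have "\<dots> = (\<Sum>a<l. \<Sum>c<m. cnj (w a) * (cnj (A c a) * x c))"
    by (rule sum.swap)
  finally show ?thesis by (simp add: sum_distrib_left)
qed

lemma qform_gram: "qform l (gram m A) x = cnorm2 m (mat_app l A x)"
proof -
  have "(\<Sum>i<l. \<Sum>j<l. cnj (x i) * gram m A i j * x j) =
      (\<Sum>a<l. cnj (x a) * (\<Sum>c<m. cnj (A c a) * mat_app l A x c))"
  proof (rule sum.cong)
    fix a
    have "(\<Sum>j<l. gram m A a j * x j) = (\<Sum>j<l. \<Sum>c<m. cnj (A c a) * (A c j * x j))"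
      by (simp add: gram_def sum_distrib_right mult.assoc)
    also have "\<dots> = (\<Sum>c<m. \<Sum>j<l. cnj (A c a) * (A c j * x j))"
      by (rule sum.swap)
    also have "\<dots> = (\<Sum>c<m. cnj (A c a) * mat_app l A x c)"
      by (simp add: mat_app_def sum_distrib_left)
    finally show "(\<Sum>j<l. cnj (x a) * gram m A a j * x j) =
        cnj (x a) * (\<Sum>c<m. cnj (A c a) * mat_app l A x c)"
      by (simp add: mult.assoc flip: sum_distrib_left)
  qed simp
  also have "\<dots> = (\<Sum>c<m. cnj (mat_app l A x c) * mat_app l A x c)"
    by (rule sum_cnj_mat_app[symmetric])
  also have "\<dots> = of_real (cnorm2 m (mat_app l A x))"
    by (simp add: cnorm2_def complex_norm_square mult.commute del: of_real_power)
  finally show ?thesis by (simp add: qform_def)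
qed

text \<open>The inverse is the adjugate divided by the determinant.\<close>

lemma cdet_nonzero_inverse:
  assumes "cdet l G \<noteq> 0"
  obtains g where
    "\<And>a b. a < l \<Longrightarrow> b < l \<Longrightarrow> (\<Sum>k<l. G a k * g k b) = (if a = b then 1 else 0)"
    "\<And>a b. a < l \<Longrightarrow> b < l \<Longrightarrow> (\<Sum>k<l. g a k * G k b) = (if a = b then 1 else 0)"
proof -
  let ?G = "mat l l (\<lambda>(i, j). G i j)"
  let ?d = "cdet l G"
  have G: "?G \<in> carrier_mat l l" by simp
  define g where "g = (\<lambda>i j. adj_mat ?G $$ (i, j) / ?d)"
  note adj = adj_mat[OF G]
  show ?thesis
  proof
    fix a b assume ab: "a < l" "b < l"
    have "(\<Sum>k<l. G a k * adj_mat ?G $$ (k, b)) = (?G * adj_mat ?G) $$ (a, b)"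
      using ab adj(1) by (simp add: scalar_prod_def atLeast0LessThan)
    also have "\<dots> = (if a = b then ?d else 0)"
      unfolding adj(2) using ab by (simp add: cdet_eq_det)
    finally show "(\<Sum>k<l. G a k * g k b) = (if a = b then 1 else 0)"
      using assms by (simp add: g_def flip: sum_divide_distrib)
    have "(\<Sum>k<l. adj_mat ?G $$ (a, k) * G k b) = (adj_mat ?G * ?G) $$ (a, b)"
      using ab adj(1) by (simp add: scalar_prod_def atLeast0LessThan)
    also have "\<dots> = (if a = b then ?d else 0)"
      unfolding adj(3) using ab by (simp add: cdet_eq_det)
    finally show "(\<Sum>k<l. g a k * G k b) = (if a = b then 1 else 0)"
      using assms by (simp add: g_def flip: sum_divide_distrib)
  qed
qed

text \<open>Full column rank is phrased as a trivial kernel, the form from which positive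
  definiteness of the Gram matrix can be read off.\<close>

locale full_rank =
  fixes m l :: nat and A :: "nat \<Rightarrow> nat \<Rightarrow> complex"
  assumes inj: "\<And>x i. (\<And>c. c < m \<Longrightarrow> mat_app l A x c = 0) \<Longrightarrow> i < l \<Longrightarrow> x i = 0"
begin

definition q :: "(nat \<Rightarrow> complex) \<Rightarrow> real" where
  "q x = cnorm2 m (mat_app l A x)"

lemma q_pos:
  assumes "i < l" "x i \<noteq> 0"
  shows "q x > 0"
proof -
  obtain c where c: "c < m" "mat_app l A x c \<noteq> 0" using inj assms by blast
  then show ?thesis unfolding q_def cnorm2_def by (intro sum_pos2[of _ c]) auto
qed

lemma q_cong: "(\<And>i. i < l \<Longrightarrow> x i = y i) \<Longrightarrow> q x = q y"
  unfolding q_def by (metis mat_app_cong)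

lemma borel_measurable_q [measurable]: "q \<in> borel_measurable (LC {..<l})"
  unfolding q_def cnorm2_def by measurable

lemma hermitian_pd_gram: "hermitian_pd l (gram m A)"
  unfolding hermitian_pd_def qform_gram
proof (intro conjI allI impI)
  show "gram m A i j = cnj (gram m A j i)" for i j
    by (simp add: gram_def mult.commute)
  show "cnorm2 m (mat_app l A x) > 0" if "\<exists>i<l. x i \<noteq> 0" for x
    using that q_pos unfolding q_def by blast
qed

lemma nn_integral_q:
  obtains d where "d > 0" "cdet l (gram m A) = of_real d"
    "\<And>f. f \<in> borel_measurable borel \<Longrightarrow>
      (\<integral>\<^sup>+u. f (q u) \<partial>LC {..<l}) = ennreal (1 / d) * (\<integral>\<^sup>+u. f (cnorm2 l u) \<partial>LC {..<l})"
  using nn_integral_qform[OF hermitian_pd_gram] unfolding qform_gram q_def[symmetric] by blast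

text \<open>With \<open>v = p - s\<close>, expanding \<open>q\<close> at \<open>(u - p) + v\<close>
  cancels the terms quadratic in \<open>u\<close>, so ties form a real affine hyperplane. Its normal
  \<open>w\<close> is nonzero because \<open>w\<close> applied to \<open>v\<close> gives
  \<open>q v > 0\<close>. This is why cells overlap only in null sets.\<close>

lemma AE_q_bisector:
  assumes "\<exists>i<l. s i \<noteq> p i"
  shows "AE u in LC {..<l}. q (\<lambda>i. u i - s i) \<noteq> q (\<lambda>i. u i - p i)"
proof -
  define v where "v = (\<lambda>i. p i - s i)"
  define w where "w = (\<lambda>a. \<Sum>c<m. cnj (mat_app l A v c) * A c a)"
  have w: "(\<Sum>c<m. cnj (mat_app l A v c) * mat_app l A x c) = (\<Sum>a<l. w a * x a)" for x
    unfolding w_def mat_app_def[of l A x] sum_distrib_left sum_distrib_right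
    by (subst sum.swap) (simp add: mult.assoc)
  have "q v > 0" using assms q_pos[of _ v] by (auto simp: v_def)
  moreover have "of_real (q v) = (\<Sum>a<l. w a * v a)"
    unfolding w[symmetric] q_def
    by (simp add: cnorm2_def complex_norm_square mult.commute del: of_real_power)
  ultimately have "(\<Sum>a<l. w a * v a) \<noteq> 0"
    by (metis of_real_eq_0_iff less_irrefl)
  then obtain i where i: "i < l" "w i \<noteq> 0"
    by (metis (no_types, lifting) lessThan_iff mult_eq_0_iff sum.neutral)
  have diff: "q (\<lambda>i. u i - s i) = q (\<lambda>i. u i - p i) + q v
      + 2 * (Re (\<Sum>a<l. w a * u a) - Re (\<Sum>a<l. w a * p a))" for u
  proof -
    have "q (\<lambda>i. u i - s i) = q (\<lambda>i. (u i - p i) + v i)" by (simp add: v_def)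
    also have "\<dots> = q (\<lambda>i. u i - p i) + q v + 2 * Re (\<Sum>a<l. w a * (u a - p a))"
      unfolding q_def mat_app_add cnorm2_add w ..
    also have "(\<Sum>a<l. w a * (u a - p a)) = (\<Sum>a<l. w a * u a) - (\<Sum>a<l. w a * p a)"
      by (simp add: right_diff_distrib sum_subtractf)
    finally show ?thesis by simp
  qed
  have ae: "AE u in LC {..<l}. Re (\<Sum>a<l. w a * u a) \<noteq> Re (\<Sum>a<l. w a * p a) - q v / 2"
    using i by (intro AE_LC_hyperplane[of _ i]) auto
  have arith: "a = b - v / 2" if "x = y + v + 2 * (a - b)" "x = y" for x y v a b :: real
    using that by simp
  from ae show ?thesis
  proof eventually_elim
    case (elim u)
    show ?case
    proof
      assume "q (\<lambda>i. u i - s i) = q (\<lambda>i. u i - p i)"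
      with diff[of u] have "Re (\<Sum>a<l. w a * u a) = Re (\<Sum>a<l. w a * p a) - q v / 2"
        by (rule arith)
      with elim show False by contradiction
    qed
  qed
qed

text \<open>\<open>B\<close> is the pseudoinverse, the inverse Gram matrix times the adjoint of
  \<open>A\<close>. The two properties together make \<open>A\<close> after \<open>B\<close> the
  orthogonal projection onto the range.\<close>

lemma left_inverse:
  obtains B where
    "\<And>a y. a < l \<Longrightarrow> (\<Sum>d<m. B a d * mat_app l A y d) = y a"
    "\<And>z a. a < l \<Longrightarrow> (\<Sum>c<m. cnj (A c a) * (z c - mat_app l A (\<lambda>b. \<Sum>d<m. B b d * z d) c)) = 0"
proof -
  obtain d where "d > 0" "cdet l (gram m A) = of_real d" by (rule nn_integral_q)
  then have "cdet l (gram m A) \<noteq> 0" by simp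
  then obtain g where
    g: "\<And>a b. a < l \<Longrightarrow> b < l \<Longrightarrow> (\<Sum>k<l. gram m A a k * g k b) = (if a = b then 1 else 0)"
      "\<And>a b. a < l \<Longrightarrow> b < l \<Longrightarrow> (\<Sum>k<l. g a k * gram m A k b) = (if a = b then 1 else 0)"
    by (rule cdet_nonzero_inverse) blast
  define B where "B = (\<lambda>a d. \<Sum>k<l. g a k * cnj (A d k))"
  have adj: "(\<Sum>c<m. cnj (A c k) * mat_app l A y c) = (\<Sum>b<l. gram m A k b * y b)" for k y
    unfolding gram_def mat_app_def sum_distrib_left sum_distrib_right
    by (subst sum.swap) (simp add: mult.assoc)
  have Bz: "(\<Sum>d<m. B a d * z d) = (\<Sum>k<l. g a k * (\<Sum>c<m. cnj (A c k) * z c))" for a z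
    unfolding B_def sum_distrib_left sum_distrib_right
    by (subst sum.swap) (simp add: mult.assoc)
  show ?thesis
  proof
    fix a y assume a: "a < l"
    have "(\<Sum>d<m. B a d * mat_app l A y d) = (\<Sum>k<l. \<Sum>b<l. g a k * gram m A k b * y b)"
      unfolding Bz adj by (simp add: sum_distrib_left mult.assoc)
    also have "\<dots> = (\<Sum>b<l. (\<Sum>k<l. g a k * gram m A k b) * y b)"
      by (subst sum.swap) (simp add: sum_distrib_right)
    also have "\<dots> = (\<Sum>b<l. if a = b then y b else 0)"
      using a by (intro sum.cong) (auto simp: g)
    also have "\<dots> = y a" using a by simp
    finally show "(\<Sum>d<m. B a d * mat_app l A y d) = y a" .
  next
    fix z a assume a: "a < l"
    let ?h = "\<lambda>k. \<Sum>c<m. cnj (A c k) * z c"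
    have "(\<Sum>c<m. cnj (A c a) * mat_app l A (\<lambda>b. \<Sum>d<m. B b d * z d) c) =
        (\<Sum>b<l. \<Sum>k<l. gram m A a b * g b k * ?h k)"
      unfolding Bz adj by (simp add: sum_distrib_left mult.assoc)
    also have "\<dots> = (\<Sum>k<l. (\<Sum>b<l. gram m A a b * g b k) * ?h k)"
      by (subst sum.swap) (simp add: sum_distrib_right)
    also have "\<dots> = (\<Sum>k<l. if a = k then ?h k else 0)"
      using a by (intro sum.cong) (auto simp: g)
    also have "\<dots> = ?h a" using a by simp
    finally show "(\<Sum>c<m. cnj (A c a) * (z c - mat_app l A (\<lambda>b. \<Sum>d<m. B b d * z d) c)) = 0"
      by (simp add: right_diff_distrib sum_subtractf)
  qed
qed

text \<open>\<open>U z\<close> holds the coordinates of the projection of \<open>z\<close> onto the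
  range of \<open>A\<close>. The weight \<open>K\<close> is the Gaussian factor of the residual:
  moving \<open>z\<close> by \<open>A y\<close> shifts \<open>U z\<close> by \<open>y\<close> and
  leaves \<open>K\<close> alone, as \<open>haar_transfer\<close> requires. The law of
  \<open>U z\<close> is stated multiplied by its normalising integral, which avoids a division in
  \<open>ennreal\<close>.\<close>

lemma projection:
  assumes s: "s > 0"
  obtains U where "U \<in> LC {..<m} \<rightarrow>\<^sub>M LC {..<l}"
    "\<And>z v. cnorm2 m (\<lambda>c. z c + mat_app l A v c) =
      cnorm2 m (\<lambda>c. z c - mat_app l A (U z) c) + q (\<lambda>i. U z i + v i)"
    "\<And>f. f \<in> borel_measurable (LC {..<l}) \<Longrightarrow>
      (\<integral>\<^sup>+z. f (U z) \<partial>noise m s) * (\<integral>\<^sup>+u. ennreal (exp (- q u / s)) \<partial>LC {..<l}) =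
      (\<integral>\<^sup>+u. f u * ennreal (exp (- q u / s)) \<partial>LC {..<l})"
proof -
  obtain B where B: "\<And>a y. a < l \<Longrightarrow> (\<Sum>d<m. B a d * mat_app l A y d) = y a"
    and orth: "\<And>z a. a < l \<Longrightarrow>
      (\<Sum>c<m. cnj (A c a) * (z c - mat_app l A (\<lambda>b. \<Sum>d<m. B b d * z d) c)) = 0"
    by (rule left_inverse) blast
  define U where "U = (\<lambda>z. \<lambda>a\<in>{..<l}. \<Sum>d<m. B a d * z d)"
  have AU: "mat_app l A (U z) = mat_app l A (\<lambda>b. \<Sum>d<m. B b d * z d)" for z
    by (rule mat_app_cong) (simp add: U_def)
  have U [measurable]: "U \<in> LC {..<m} \<rightarrow>\<^sub>M LC {..<l}"
    unfolding U_def by measurable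
  have pyth: "cnorm2 m (\<lambda>c. z c + mat_app l A v c) =
      cnorm2 m (\<lambda>c. z c - mat_app l A (U z) c) + q (\<lambda>i. U z i + v i)" for z v
  proof -
    \<comment> \<open>The residual is orthogonal to the range, hence the cross term of
      \<open>cnorm2_add\<close> vanishes.\<close>
    have "cnorm2 m (\<lambda>c. z c + mat_app l A v c) =
      cnorm2 m (\<lambda>c. (z c - mat_app l A (U z) c) + mat_app l A (\<lambda>i. U z i + v i) c)"
      by (simp add: mat_app_add)
    also have "\<dots> = cnorm2 m (\<lambda>c. z c - mat_app l A (U z) c) + q (\<lambda>i. U z i + v i)"
      unfolding cnorm2_add sum_cnj_mat_app AU q_def by (simp add: orth)
    finally show ?thesis .
  qed
  define K where "K = (\<lambda>z. ennreal (exp (- cnorm2 m (\<lambda>c. z c - mat_app l A (U z) c) / s)))"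
  have UA: "U (\<lambda>i\<in>{..<m}. mat_app l A y i + z i) = (\<lambda>j\<in>{..<l}. y j + U z j)" for y z
    by (auto simp: U_def fun_eq_iff restrict_def B distrib_left sum.distrib)
  have KA: "K (\<lambda>i\<in>{..<m}. mat_app l A y i + z i) = K z" for y z
  proof -
    have "mat_app l A (\<lambda>j\<in>{..<l}. y j + U z j) = mat_app l A (\<lambda>j. y j + U z j)"
      by (rule mat_app_cong) simp
    then have "cnorm2 m (\<lambda>c. (\<lambda>i\<in>{..<m}. mat_app l A y i + z i) c - mat_app l A (\<lambda>j\<in>{..<l}. y j + U z j) c)
       = cnorm2 m (\<lambda>c. z c - mat_app l A (U z) c)"
      by (intro cnorm2_cong) (simp add: mat_app_add)
    then show ?thesis unfolding K_def UA by simp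
  qed
  have Kexp: "K z * ennreal (exp (- q (U z) / s)) = ennreal (exp (- cnorm2 m z / s))" for z
  proof -
    have "cnorm2 m z = cnorm2 m (\<lambda>c. z c - mat_app l A (U z) c) + q (U z)"
      using pyth[of z "\<lambda>_. 0"] by (simp add: mat_app_def)
    then have "- cnorm2 m z / s = - cnorm2 m (\<lambda>c. z c - mat_app l A (U z) c) / s + - q (U z) / s"
      by (simp add: add_divide_distrib diff_divide_distrib)
    then show ?thesis
      unfolding K_def by (simp only: exp_add) (rule ennreal_mult'[symmetric], simp)
  qed
  have "(\<lambda>z. mat_app l A (U z) c) \<in> borel_measurable (LC {..<m})" for c
    using measurable_compose[OF U borel_measurable_mat_app] .
  then have [measurable]: "K \<in> borel_measurable (LC {..<m})"
    unfolding K_def cnorm2_def by measurable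
  show ?thesis
  proof (rule that[OF U pyth])
    fix f :: "(nat \<Rightarrow> complex) \<Rightarrow> ennreal" assume f [measurable]: "f \<in> borel_measurable (LC {..<l})"
    \<comment> \<open>With the bare Gaussian weight as \<open>g\<close>, the comparison integral is
      that of the full Gaussian, \<open>(pi * s) ^ m\<close>, which the normalisation of the noise
      cancels afterwards.\<close>
    have "(\<integral>\<^sup>+z. K z * (f (U z) * ennreal (exp (- q (U z) / s))) \<partial>LC {..<m}) *
        (\<integral>\<^sup>+u. ennreal (exp (- q u / s)) \<partial>LC {..<l}) =
      (\<integral>\<^sup>+z. K z * ennreal (exp (- q (U z) / s)) \<partial>LC {..<m}) *
        (\<integral>\<^sup>+u. f u * ennreal (exp (- q u / s)) \<partial>LC {..<l})"
      by (rule haar_transfer[where A = "\<lambda>y i. mat_app l A y i" and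
          f = "\<lambda>u. f u * ennreal (exp (- q u / s))" and g = "\<lambda>u. ennreal (exp (- q u / s))"])
         (simp_all add: UA KA)
    moreover have "K z * (f (U z) * ennreal (exp (- q (U z) / s))) =
        f (U z) * ennreal (exp (- cnorm2 m z / s))" for z
      unfolding Kexp[symmetric] by (simp only: ac_simps)
    ultimately have eq: "(\<integral>\<^sup>+z. f (U z) * ennreal (exp (- cnorm2 m z / s)) \<partial>LC {..<m}) *
        (\<integral>\<^sup>+u. ennreal (exp (- q u / s)) \<partial>LC {..<l}) =
      ennreal ((pi * s) ^ m) * (\<integral>\<^sup>+u. f u * ennreal (exp (- q u / s)) \<partial>LC {..<l})"
      unfolding Kexp nn_integral_gaussian_LC[OF s] by (simp only:)
    have fU [measurable]: "(\<lambda>z. f (U z)) \<in> borel_measurable (LC {..<m})" by measurable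
    have "(\<integral>\<^sup>+z. f (U z) \<partial>noise m s) =
       (\<integral>\<^sup>+z. ennreal (exp (- cnorm2 m z / s) / (pi * s) ^ m) * f (U z) \<partial>LC {..<m})"
      unfolding noise_eq_density[OF s] by (rule nn_integral_density) auto
    also have "\<dots> = (\<integral>\<^sup>+z. ennreal (1 / (pi * s) ^ m) * (f (U z) * ennreal (exp (- cnorm2 m z / s))) \<partial>LC {..<m})"
    proof (rule nn_integral_cong)
      fix z
      have "ennreal (exp (- cnorm2 m z / s) / (pi * s) ^ m) =
          ennreal (1 / (pi * s) ^ m) * ennreal (exp (- cnorm2 m z / s))"
        using s by (subst ennreal_mult'[symmetric]) auto
      then show "ennreal (exp (- cnorm2 m z / s) / (pi * s) ^ m) * f (U z) =
          ennreal (1 / (pi * s) ^ m) * (f (U z) * ennreal (exp (- cnorm2 m z / s)))"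
        by (simp only: ac_simps)
    qed
    also have "\<dots> = ennreal (1 / (pi * s) ^ m) * (\<integral>\<^sup>+z. f (U z) * ennreal (exp (- cnorm2 m z / s)) \<partial>LC {..<m})"
      by (rule nn_integral_cmult) simp
    finally have "(\<integral>\<^sup>+z. f (U z) \<partial>noise m s) * (\<integral>\<^sup>+u. ennreal (exp (- q u / s)) \<partial>LC {..<l}) =
      ennreal (1 / (pi * s) ^ m) * ennreal ((pi * s) ^ m) *
        (\<integral>\<^sup>+u. f u * ennreal (exp (- q u / s)) \<partial>LC {..<l})"
      by (simp only: mult.assoc eq)
    also have "ennreal (1 / (pi * s) ^ m) * ennreal ((pi * s) ^ m) = 1"
      using s by (subst ennreal_mult'[symmetric]) auto
    finally show "(\<integral>\<^sup>+z. f (U z) \<partial>noise m s) * (\<integral>\<^sup>+u. ennreal (exp (- q u / s)) \<partial>LC {..<l}) =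
      (\<integral>\<^sup>+u. f u * ennreal (exp (- q u / s)) \<partial>LC {..<l})" by simp
  qed
qed

section \<open>Voronoi cells in the coordinates of the range\<close>

lemma borel_measurable_q_shift [measurable]:
  "(\<lambda>u. q (\<lambda>i. u i + v i)) \<in> borel_measurable (LC {..<l})"
proof -
  have "(\<lambda>u. q (\<lambda>i\<in>{..<l}. u i + v i)) \<in> borel_measurable (LC {..<l})" by measurable
  also have "(\<lambda>u. q (\<lambda>i\<in>{..<l}. u i + v i)) = (\<lambda>u. q (\<lambda>i. u i + v i))"
    by (intro ext q_cong) simp
  finally show ?thesis .
qed

text \<open>The Voronoi cell of \<open>s\<close> for \<open>q\<close>, translated so that
  \<open>s\<close> becomes the origin. All cells then face the same Gaussian density and the same
  ball.\<close>

definition cell :: "(nat \<Rightarrow> complex) set \<Rightarrow> (nat \<Rightarrow> complex) \<Rightarrow> (nat \<Rightarrow> complex) set" where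
  "cell S s = {u \<in> space (LC {..<l}). \<forall>p\<in>S. q u \<le> q (\<lambda>i. u i + (s i - p i))}"

lemma sets_cell [measurable]:
  assumes "countable S"
  shows "cell S s \<in> sets (LC {..<l})"
proof (cases "S = {}")
  case False
  then have "cell S s = (\<Inter>p\<in>S. {u \<in> space (LC {..<l}). q u \<le> q (\<lambda>i. u i + (s i - p i))})"
    by (auto simp: cell_def)
  also have "\<dots> \<in> sets (LC {..<l})"
    using assms False by (intro sets.countable_INT') auto
  finally show ?thesis .
qed (simp add: cell_def)

lemma sum_emeasure_cell_le:
  assumes "countable S" "finite C" "C \<subseteq> S \<inter> Cb a l" "0 < a" "0 < \<rho>"
  shows "(\<Sum>s\<in>C. emeasure (LC {..<l}) (cell S s \<inter> cube l \<rho>)) \<le> ennreal ((a + 2 * \<rho>) ^ (2 * l))"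
proof -
  define sh where "sh = (\<lambda>s x. \<lambda>i\<in>{..<l}. - s i + x i :: complex)"
  \<comment> \<open>The indicator of the cut-off cell put back at its centre \<open>s\<close>;
    translation invariance preserves its volume.\<close>
  define T where "T = (\<lambda>s x. indicator (cell S s \<inter> cube l \<rho>) (sh s x) :: ennreal)"
  have [measurable]: "cell S s \<inter> cube l \<rho> \<in> sets (LC {..<l})" for s
    using assms(1) by measurable
  have sh [measurable]: "sh s \<in> LC {..<l} \<rightarrow>\<^sub>M LC {..<l}" for s
    unfolding sh_def by measurable
  have T [measurable]: "T s \<in> borel_measurable (LC {..<l})" for s
    unfolding T_def by measurable
  have "emeasure (LC {..<l}) (cell S s \<inter> cube l \<rho>) = (\<integral>\<^sup>+x. T s x \<partial>LC {..<l})" for s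
    unfolding T_def sh_def by (subst nn_integral_LC_translate) auto
  then have "(\<Sum>s\<in>C. emeasure (LC {..<l}) (cell S s \<inter> cube l \<rho>)) = (\<integral>\<^sup>+x. (\<Sum>s\<in>C. T s x) \<partial>LC {..<l})"
    by (simp add: nn_integral_sum)
  also have "\<dots> \<le> (\<integral>\<^sup>+x. indicator (cube l (a / 2 + \<rho>)) x \<partial>LC {..<l})"
  proof (rule nn_integral_mono_AE)
    \<comment> \<open>Off the bisectors of the finitely many pairs in \<open>C\<close>, at most one
      summand is nonzero at \<open>x\<close>.\<close>
    have ae: "AE x in LC {..<l}. \<forall>s\<in>C. \<forall>p\<in>C. s \<noteq> p \<longrightarrow> q (\<lambda>i. x i - s i) \<noteq> q (\<lambda>i. x i - p i)"
    proof (intro AE_finite_allI assms(2))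
      fix s p assume sp: "s \<in> C" "p \<in> C"
      show "AE x in LC {..<l}. s \<noteq> p \<longrightarrow> q (\<lambda>i. x i - s i) \<noteq> q (\<lambda>i. x i - p i)"
      proof (cases "s = p")
        case False
        then obtain i where "s i \<noteq> p i" by auto
        moreover from this have "i < l"
        proof (rule contrapos_np)
          \<comment> \<open>Points of \<open>Cb\<close> vanish beyond \<open>l\<close>, so distinct
            ones already differ at an index below \<open>l\<close>.\<close>
          assume "\<not> i < l"
          moreover have "s \<in> Cb a l" "p \<in> Cb a l" using sp assms(3) by auto
          ultimately show "s i = p i" by (simp add: Cb_def cvec_def)
        qed
        ultimately have "\<exists>i<l. s i \<noteq> p i" by blast
        from AE_q_bisector[OF this] show ?thesis by eventually_elim simp
      qed simp
    qed
    then show "AE x in LC {..<l}. (\<Sum>s\<in>C. T s x) \<le> indicator (cube l (a / 2 + \<rho>)) x"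
      using AE_space
    proof eventually_elim
      case (elim x)
      show ?case
      proof (cases "\<exists>s\<in>C. sh s x \<in> cell S s \<inter> cube l \<rho>")
        case True
        then obtain s where s: "s \<in> C" "sh s x \<in> cell S s" "sh s x \<in> cube l \<rho>" by blast
        have cellD: "q (\<lambda>i. x i - s i) \<le> q (\<lambda>i. x i - p i)"
          if "p \<in> C" "sh s x \<in> cell S s" for s p
        proof -
          have "q (sh s x) \<le> q (\<lambda>i. sh s x i + (s i - p i))"
            using that assms(3) by (auto simp: cell_def)
          moreover have "q (sh s x) = q (\<lambda>i. x i - s i)"
            by (rule q_cong) (simp add: sh_def)
          moreover have "q (\<lambda>i. sh s x i + (s i - p i)) = q (\<lambda>i. x i - p i)"
            by (rule q_cong) (simp add: sh_def)
          ultimately show ?thesis by simp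
        qed
        have "T p x = 0" if "p \<in> C - {s}" for p
        proof (rule ccontr)
          assume "T p x \<noteq> 0"
          then have "sh p x \<in> cell S p" by (auto simp: T_def split: split_indicator_asm)
          then have "q (\<lambda>i. x i - s i) = q (\<lambda>i. x i - p i)"
            using cellD[of s p] cellD[of p s] s that by (intro antisym) auto
          then show False using elim(1) s that by auto
        qed
        then have "(\<Sum>p\<in>C - {s}. T p x) = 0" by (rule sum.neutral[rule_format])
        then have "(\<Sum>s\<in>C. T s x) = T s x"
          using sum.remove[OF assms(2) s(1), of "\<lambda>s. T s x"] by simp
        moreover have "x \<in> cube l (a / 2 + \<rho>)"
        proof -
          have "\<bar>Re (x i)\<bar> < a / 2 + \<rho>" "\<bar>Im (x i)\<bar> < a / 2 + \<rho>" if "i < l" for i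
          proof -
            have "\<bar>Re (s i)\<bar> < a / 2" "\<bar>Im (s i)\<bar> < a / 2"
              using s(1) assms(3) that by (auto simp: Cb_def)
            moreover have "\<bar>- Re (s i) + Re (x i)\<bar> < \<rho>" "\<bar>- Im (s i) + Im (x i)\<bar> < \<rho>"
              using s(3) that by (auto simp: cube_def sh_def)
            ultimately show "\<bar>Re (x i)\<bar> < a / 2 + \<rho>" "\<bar>Im (x i)\<bar> < a / 2 + \<rho>"
              by linarith+
          qed
          then show ?thesis using elim(2) by (simp add: cube_def)
        qed
        ultimately show ?thesis by (simp add: T_def split: split_indicator)
      next
        case False
        then have "T s x = 0" if "s \<in> C" for s using that by (auto simp: T_def)
        then show ?thesis by simp
      qed
    qed
  qed
  also have "\<dots> = ennreal ((a + 2 * \<rho>) ^ (2 * l))"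
    using assms(4,5) by (simp add: emeasure_cube distrib_left)
  finally show ?thesis .
qed

text \<open>Pointwise, the left integrand is the minimum of the density
  \<open>exp (- q u / s)\<close> and its boundary value \<open>exp (- R / s)\<close>. The right
  integrand is everywhere at least one of the two: the density outside the cell, the boundary value
  in the cut-off cell, and again the density in the part cut away.\<close>

lemma bathtub:
  assumes "countable S" "0 < s"
  shows "(\<integral>\<^sup>+u. ennreal (exp (- q u / s)) * indicator {R..} (q u) \<partial>LC {..<l}) +
      ennreal (exp (- R / s)) * emeasure (LC {..<l}) {u \<in> space (LC {..<l}). q u < R}
    \<le> (\<integral>\<^sup>+u. indicator (space (LC {..<l}) - cell S p) u * ennreal (exp (- q u / s)) \<partial>LC {..<l}) +
      ennreal (exp (- R / s)) * emeasure (LC {..<l}) (cell S p \<inter> cube l \<rho>) +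
      (\<integral>\<^sup>+u. ennreal (exp (- q u / s)) * indicator (space (LC {..<l}) - cube l \<rho>) u \<partial>LC {..<l})"
    (is "?A + ?B \<le> ?C + ?D + ?E")
proof -
  let ?\<phi> = "\<lambda>u. ennreal (exp (- q u / s))" and ?c = "ennreal (exp (- R / s))"
  have [measurable]: "cell S p \<in> sets (LC {..<l})" by (rule sets_cell) fact
  have B: "?B = (\<integral>\<^sup>+u. ?c * indicator {u \<in> space (LC {..<l}). q u < R} u \<partial>LC {..<l})"
    by (subst nn_integral_cmult_indicator) auto
  have D: "?D = (\<integral>\<^sup>+u. ?c * indicator (cell S p \<inter> cube l \<rho>) u \<partial>LC {..<l})"
    by (subst nn_integral_cmult_indicator) auto
  have "?A + ?B = (\<integral>\<^sup>+u. ?\<phi> u * indicator {R..} (q u) +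
      ?c * indicator {u \<in> space (LC {..<l}). q u < R} u \<partial>LC {..<l})"
    unfolding B by (rule nn_integral_add[symmetric]) auto
  also have "\<dots> \<le> (\<integral>\<^sup>+u. indicator (space (LC {..<l}) - cell S p) u * ?\<phi> u +
      ?c * indicator (cell S p \<inter> cube l \<rho>) u +
      ?\<phi> u * indicator (space (LC {..<l}) - cube l \<rho>) u \<partial>LC {..<l})"
  proof (rule nn_integral_mono)
    fix u assume u: "u \<in> space (LC {..<l})"
    have lt: "?c \<le> ?\<phi> u" if "q u < R"
      using that assms(2) by (auto intro!: ennreal_leI simp: divide_right_mono)
    have ge: "?\<phi> u \<le> ?c" if "R \<le> q u"
      using that assms(2) by (auto intro!: ennreal_leI simp: divide_right_mono)
    have "x * indicator {R..} (q u) + c * indicator {u \<in> space (LC {..<l}). q u < R} u \<le>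
      indicator (space (LC {..<l}) - cell S p) u * x + c * indicator (cell S p \<inter> cube l \<rho>) u +
      x * indicator (space (LC {..<l}) - cube l \<rho>) u"
      if "q u < R \<Longrightarrow> c \<le> x" "R \<le> q u \<Longrightarrow> x \<le> c" for x c :: ennreal
      by (cases "q u < R"; cases "u \<in> cell S p"; cases "u \<in> cube l \<rho>")
        (use u that in \<open>simp_all add: add_increasing\<close>)
    then show "?\<phi> u * indicator {R..} (q u) + ?c * indicator {u \<in> space (LC {..<l}). q u < R} u \<le>
      indicator (space (LC {..<l}) - cell S p) u * ?\<phi> u + ?c * indicator (cell S p \<inter> cube l \<rho>) u +
      ?\<phi> u * indicator (space (LC {..<l}) - cube l \<rho>) u"
      using lt ge by blast
  qed
  also have "\<dots> = ?C + ?D + ?E"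
    unfolding D by (subst nn_integral_add, simp, simp, subst nn_integral_add) auto
  finally show ?thesis .
qed

text \<open>The received point is measured from the image of \<open>s\<close>, so only differences
  of constellation points enter, and the competitors range over \<open>S\<close> instead of its
  image.\<close>

definition err :: "real \<Rightarrow> (nat \<Rightarrow> complex) set \<Rightarrow> (nat \<Rightarrow> complex) \<Rightarrow> real" where
  "err \<sigma> S s = measure (noise m \<sigma>) {z \<in> space (noise m \<sigma>).
     \<not> (\<forall>p\<in>S. cnorm2 m z \<le> cnorm2 m (\<lambda>c. z c + mat_app l A (\<lambda>i. s i - p i) c))}"

text \<open>By Pythagoras both sides of a distance comparison contain the same noise residual. Once
  it cancels, the comparison is the one defining \<open>cell\<close>, evaluated at
  \<open>U z\<close>.\<close>

lemma err_eq:
  assumes "countable S" "0 < \<sigma>"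
  shows "ennreal (err \<sigma> S s) * (\<integral>\<^sup>+u. ennreal (exp (- q u / \<sigma>)) \<partial>LC {..<l}) =
    (\<integral>\<^sup>+u. indicator (space (LC {..<l}) - cell S s) u * ennreal (exp (- q u / \<sigma>)) \<partial>LC {..<l})"
proof -
  interpret N: prob_space "noise m \<sigma>" by (rule prob_space_noise) fact
  obtain U where U: "U \<in> LC {..<m} \<rightarrow>\<^sub>M LC {..<l}"
    and pyth: "\<And>z v. cnorm2 m (\<lambda>c. z c + mat_app l A v c) =
      cnorm2 m (\<lambda>c. z c - mat_app l A (U z) c) + q (\<lambda>i. U z i + v i)"
    and law: "\<And>f. f \<in> borel_measurable (LC {..<l}) \<Longrightarrow>
      (\<integral>\<^sup>+z. f (U z) \<partial>noise m \<sigma>) * (\<integral>\<^sup>+u. ennreal (exp (- q u / \<sigma>)) \<partial>LC {..<l}) =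
      (\<integral>\<^sup>+u. f u * ennreal (exp (- q u / \<sigma>)) \<partial>LC {..<l})"
    by (rule projection[OF assms(2)]) blast
  have [measurable]: "U \<in> noise m \<sigma> \<rightarrow>\<^sub>M LC {..<l}"
    unfolding measurable_cong_sets[OF sets_noise refl] by (rule U)
  have [measurable]: "cell S s \<in> sets (LC {..<l})" by (rule sets_cell) fact
  have iff: "(\<forall>p\<in>S. cnorm2 m z \<le> cnorm2 m (\<lambda>c. z c + mat_app l A (\<lambda>i. s i - p i) c)) \<longleftrightarrow> U z \<in> cell S s"
    if "z \<in> space (noise m \<sigma>)" for z
  proof -
    have "U z \<in> space (LC {..<l})"
      using that by (rule measurable_space[rotated]) measurable
    moreover have "cnorm2 m z = cnorm2 m (\<lambda>c. z c - mat_app l A (U z) c) + q (U z)"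
      using pyth[of z "\<lambda>_. 0"] by (simp add: mat_app_def)
    ultimately show ?thesis
      unfolding cell_def pyth by simp
  qed
  have "{z \<in> space (noise m \<sigma>).
     \<not> (\<forall>p\<in>S. cnorm2 m z \<le> cnorm2 m (\<lambda>c. z c + mat_app l A (\<lambda>i. s i - p i) c))} =
     {z \<in> space (noise m \<sigma>). U z \<notin> cell S s}"
    using iff by blast
  then have "ennreal (err \<sigma> S s) = emeasure (noise m \<sigma>) {z \<in> space (noise m \<sigma>). U z \<notin> cell S s}"
    by (simp add: err_def N.emeasure_eq_measure)
  also have "\<dots> = (\<integral>\<^sup>+z. indicator {z \<in> space (noise m \<sigma>). U z \<notin> cell S s} z \<partial>noise m \<sigma>)"
    by (rule nn_integral_indicator[symmetric]) measurable
  also have "\<dots> = (\<integral>\<^sup>+z. indicator (space (LC {..<l}) - cell S s) (U z) \<partial>noise m \<sigma>)"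
  proof (rule nn_integral_cong)
    fix z assume z: "z \<in> space (noise m \<sigma>)"
    then have "U z \<in> space (LC {..<l})"
      by (rule measurable_space[rotated]) measurable
    with z show "indicator {z \<in> space (noise m \<sigma>). U z \<notin> cell S s} z =
        (indicator (space (LC {..<l}) - cell S s) (U z) :: ennreal)"
      by (simp split: split_indicator)
  qed
  finally show ?thesis
    using law[of "indicator (space (LC {..<l}) - cell S s)"] by simp
qed

lemma err_nonneg: "err \<sigma> S s \<ge> 0"
  by (simp add: err_def)

text \<open>\<open>bathtub\<close> summed over \<open>C\<close>. Apart from the error, the cell
  enters only through its cut-off volume, and these volumes are bounded jointly by
  \<open>sum_emeasure_cell_le\<close>.\<close>

lemma sum_err_ge:
  assumes "countable S" "0 < \<sigma>" "finite C" "C \<subseteq> S \<inter> Cb a l" "0 < a" "0 < \<rho>"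
  shows "of_nat (card C) * ((\<integral>\<^sup>+u. ennreal (exp (- q u / \<sigma>)) * indicator {R..} (q u) \<partial>LC {..<l}) +
      ennreal (exp (- R / \<sigma>)) * emeasure (LC {..<l}) {u \<in> space (LC {..<l}). q u < R})
    \<le> ennreal (\<Sum>s\<in>C. err \<sigma> S s) * (\<integral>\<^sup>+u. ennreal (exp (- q u / \<sigma>)) \<partial>LC {..<l}) +
      ennreal (exp (- R / \<sigma>)) * ennreal ((a + 2 * \<rho>) ^ (2 * l)) +
      of_nat (card C) * (\<integral>\<^sup>+u. ennreal (exp (- q u / \<sigma>)) * indicator (space (LC {..<l}) - cube l \<rho>) u \<partial>LC {..<l})"
    (is "_ * ?A \<le> _ * ?Z + ?c * ?V + _ * ?E")
proof -
  have "of_nat (card C) * ?A = (\<Sum>s\<in>C. ?A)" by simp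
  also have "\<dots> \<le> (\<Sum>s\<in>C. ennreal (err \<sigma> S s) * ?Z +
      ?c * emeasure (LC {..<l}) (cell S s \<inter> cube l \<rho>) + ?E)"
    unfolding err_eq[OF assms(1,2)] by (intro sum_mono bathtub assms)
  also have "\<dots> = ennreal (\<Sum>s\<in>C. err \<sigma> S s) * ?Z +
      ?c * (\<Sum>s\<in>C. emeasure (LC {..<l}) (cell S s \<inter> cube l \<rho>)) + of_nat (card C) * ?E"
    by (simp add: sum.distrib err_nonneg flip: sum_distrib_left sum_distrib_right sum_ennreal)
  also have "\<dots> \<le> ennreal (\<Sum>s\<in>C. err \<sigma> S s) * ?Z + ?c * ?V + of_nat (card C) * ?E"
    by (intro add_mono mult_left_mono order_refl sum_emeasure_cell_le[OF assms(1,3-6)]) auto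
  finally show ?thesis .
qed

end

section \<open>The upper limit of the average error\<close>

lemma le_Limsup_frequently:
  fixes X :: "'a \<Rightarrow> 'b :: {complete_linorder, dense_linorder}"
  assumes "\<And>y. y < C \<Longrightarrow> \<exists>\<^sub>F x in F. y < X x"
  shows "C \<le> Limsup F X"
proof (rule ccontr)
  assume "\<not> C \<le> Limsup F X"
  then obtain w where w: "Limsup F X < w" "w < C"
    using dense[of "Limsup F X" C] by (auto simp: not_le)
  then have "\<forall>\<^sub>F x in F. X x < w" by (intro Limsup_lessD)
  then have "\<forall>\<^sub>F x in F. \<not> w < X x" by eventually_elim simp
  with assms[OF w(2)] show False by (simp add: frequently_def)
qed

lemma less_Limsup_frequently:
  fixes X :: "'a \<Rightarrow> 'b :: complete_linorder"
  assumes "y < Limsup F X"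
  shows "\<exists>\<^sub>F x in F. y < X x"
proof (rule ccontr)
  assume "\<not> (\<exists>\<^sub>F x in F. y < X x)"
  then have "\<forall>\<^sub>F x in F. X x \<le> y" by (simp add: not_frequently not_less)
  then have "Limsup F X \<le> y" by (rule Limsup_bounded)
  with assms show False by simp
qed

text \<open>Both \<open>card\<close> and \<open>sum\<close> return 0 on infinite sets, so finiteness
  has to be secured before counting. An infinite intersection would make the quotient
  infinite.\<close>

lemma finite_IC_inter_Cb:
  assumes "IC_density l S < \<infinity>"
  shows "\<forall>\<^sub>F a in at_top. finite (S \<inter> Cb a l)"
proof -
  have "\<forall>\<^sub>F a in at_top. npts (S \<inter> Cb a l) / ennreal (a ^ (2 * l)) < \<infinity>"
    using assms unfolding IC_density_def by (rule Limsup_lessD)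
  then show ?thesis
  proof eventually_elim
    case (elim a)
    show ?case
    proof (rule ccontr)
      assume "infinite (S \<inter> Cb a l)"
      then have "npts (S \<inter> Cb a l) = \<infinity>" by (simp add: npts_def)
      then show False using elim by (simp add: ennreal_top_divide)
    qed
  qed
qed

lemma npts_finite: "finite X \<Longrightarrow> npts X = ennreal (card X)"
  by (simp add: npts_def ennreal_of_nat_eq_real_of_nat)

lemma tendsto_power_shift_ratio:
  "((\<lambda>a::real. ((a + b) / a) ^ k) \<longlongrightarrow> 1) at_top"
proof -
  have "((\<lambda>a::real. (1 + b / a) ^ k) \<longlongrightarrow> (1 + 0) ^ k) at_top"
    by (intro tendsto_intros tendsto_divide_0[OF tendsto_const] filterlim_at_top_imp_at_infinity filterlim_ident)
  then have "((\<lambda>a::real. (1 + b / a) ^ k) \<longlongrightarrow> 1) at_top" by simp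
  then show ?thesis
    by (rule Lim_transform_eventually)
       (use eventually_gt_at_top[of 0] in \<open>eventually_elim, simp add: add_divide_distrib\<close>)
qed

context full_rank
begin

text \<open>Continuity from above of the finite Gaussian measure along growing cubes; the index
  \<open>Suc k\<close> keeps the half side positive.\<close>

lemma tail_tendsto_0:
  assumes "0 < \<sigma>" and fin: "(\<integral>\<^sup>+u. ennreal (exp (- q u / \<sigma>)) \<partial>LC {..<l}) < \<infinity>" and "0 < e"
  obtains \<rho> where "0 < \<rho>"
    "(\<integral>\<^sup>+u. ennreal (exp (- q u / \<sigma>)) * indicator (space (LC {..<l}) - cube l \<rho>) u \<partial>LC {..<l}) < ennreal e"
proof -
  define N where "N = density (LC {..<l}) (\<lambda>u. ennreal (exp (- q u / \<sigma>)))"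
  have N: "emeasure N X = (\<integral>\<^sup>+u. ennreal (exp (- q u / \<sigma>)) * indicator X u \<partial>LC {..<l})"
    if "X \<in> sets (LC {..<l})" for X
    unfolding N_def using that by (intro emeasure_density) auto
  define X where "X = (\<lambda>k. space (LC {..<l}) - cube l (real (Suc k)))"
  have X: "X k \<in> sets (LC {..<l})" for k unfolding X_def by measurable
  have "(\<lambda>k. emeasure N (X k)) \<longlonglongrightarrow> emeasure N (\<Inter>k. X k)"
  proof (rule Lim_emeasure_decseq)
    show "range X \<subseteq> sets N" using X by (auto simp: N_def)
    show "decseq X"
      unfolding decseq_def X_def cube_def by (fastforce intro: less_le_trans)
    fix k
    have "emeasure N (X k) \<le> (\<integral>\<^sup>+u. ennreal (exp (- q u / \<sigma>)) \<partial>LC {..<l})"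
      unfolding N[OF X] by (intro nn_integral_mono) (simp split: split_indicator)
    then show "emeasure N (X k) \<noteq> \<infinity>" using fin by auto
  qed
  also have "(\<Inter>k. X k) = {}"
  proof -
    have "u \<notin> (\<Inter>k. X k)" for u
    proof
      assume u: "u \<in> (\<Inter>k. X k)"
      then have us: "u \<in> space (LC {..<l})" by (auto simp: X_def)
      define b where "b = (\<Sum>i<l. cmod (u i))"
      have b: "\<bar>Re (u i)\<bar> \<le> b" "\<bar>Im (u i)\<bar> \<le> b" if "i < l" for i
        using member_le_sum[of i "{..<l}" "\<lambda>i. cmod (u i)"] that
          abs_Re_le_cmod[of "u i"] abs_Im_le_cmod[of "u i"] by (auto simp: b_def)
      obtain k where k: "b < real k" using reals_Archimedean2 by blast
      have "\<bar>Re (u i)\<bar> < real (Suc k)" "\<bar>Im (u i)\<bar> < real (Suc k)" if "i < l" for i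
        using b[OF that] k by auto
      then have "u \<in> cube l (real (Suc k))"
        using us by (simp add: cube_def)
      then show False using u by (auto simp: X_def)
    qed
    then show ?thesis by blast
  qed
  finally have "(\<lambda>k. emeasure N (X k)) \<longlonglongrightarrow> 0" by simp
  then have "\<forall>\<^sub>F k in sequentially. emeasure N (X k) < ennreal e"
    using assms(3) by (intro order_tendstoD(2)) auto
  then obtain k where "emeasure N (X k) < ennreal e"
    by (auto simp: eventually_sequentially)
  then show ?thesis
    using that[of "real (Suc k)"] unfolding N[OF X] by (simp add: X_def)
qed

text \<open>Dividing \<open>sum_err_ge\<close> by the number \<open>M\<close> of points puts
  \<open>T + c / \<gamma>\<close> on the left, since the ball has volume
  \<open>1 / \<gamma>\<close>, and \<open>c * V / M\<close> on the right. On suitable large cubes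
  the latter hardly exceeds \<open>c / \<gamma>\<close>, so the volume terms cancel and
  \<open>T\<close> remains as a lower bound for \<open>z\<close> times the average error.\<close>

lemma Limsup_avg_err_ge:
  assumes "countable S" "0 < \<sigma>" "0 < \<gamma>"
    and dens: "IC_density l S = ennreal \<gamma>"
    and vol: "emeasure (LC {..<l}) {u \<in> space (LC {..<l}). q u < R} = ennreal (1 / \<gamma>)"
    and Z: "(\<integral>\<^sup>+u. ennreal (exp (- q u / \<sigma>)) \<partial>LC {..<l}) = ennreal z" "0 < z"
  shows "(\<integral>\<^sup>+u. ennreal (exp (- q u / \<sigma>)) * indicator {R..} (q u) \<partial>LC {..<l}) / ennreal z \<le>
    Limsup at_top (\<lambda>a. ennreal ((\<Sum>s\<in>S \<inter> Cb a l. err \<sigma> S s) / real (card (S \<inter> Cb a l))))"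
proof -
  define c where "c = exp (- R / \<sigma>)"
  have c: "c > 0" by (simp add: c_def)
  have cases: thesis if "X \<le> ennreal b" "\<And>x. 0 \<le> x \<Longrightarrow> X = ennreal x \<Longrightarrow> thesis"
    for X b thesis
    using that by (cases X) (auto simp: top_unique)
  have "(\<integral>\<^sup>+u. ennreal (exp (- q u / \<sigma>)) * indicator {R..} (q u) \<partial>LC {..<l}) \<le> ennreal z"
    unfolding Z(1)[symmetric] by (intro nn_integral_mono) (simp split: split_indicator)
  then obtain T where T: "T \<ge> 0"
    "(\<integral>\<^sup>+u. ennreal (exp (- q u / \<sigma>)) * indicator {R..} (q u) \<partial>LC {..<l}) = ennreal T"
    by (rule cases)
  show ?thesis
    unfolding T(2)
  proof (rule le_Limsup_frequently)
    fix y' :: ennreal assume "y' < ennreal T / ennreal z"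
    then have y'': "y' < ennreal (T / z)" using T Z by (simp add: divide_ennreal)
    then obtain y where y: "y \<ge> 0" "y' = ennreal y" by (cases y') auto
    with y'' have yT: "y * z < T" using Z T by (simp add: ennreal_less_iff field_simps)
    \<comment> \<open>The gap is divided into three shares: for the tail outside the cut-off, for
      replacing \<open>\<gamma>\<close> by a smaller \<open>\<gamma>'\<close>, and for enlarging the
      cube by \<open>\<rho>\<close>.\<close>
    define \<eta> where "\<eta> = (T - y * z) / 3"
    have \<eta>: "\<eta> > 0" using yT by (simp add: \<eta>_def)
    obtain \<rho> where \<rho>: "0 < \<rho>"
      "(\<integral>\<^sup>+u. ennreal (exp (- q u / \<sigma>)) * indicator (space (LC {..<l}) - cube l \<rho>) u \<partial>LC {..<l}) < ennreal \<eta>"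
      by (rule tail_tendsto_0[OF assms(2) _ \<eta>]) (simp only: Z ennreal_less_top infinity_ennreal_def)
    obtain E where E: "E \<ge> 0"
      "(\<integral>\<^sup>+u. ennreal (exp (- q u / \<sigma>)) * indicator (space (LC {..<l}) - cube l \<rho>) u \<partial>LC {..<l}) = ennreal E"
      by (rule cases[OF less_imp_le[OF \<rho>(2)]])
    have E\<eta>: "E < \<eta>" using \<rho>(2) E(1) unfolding E(2) by (simp only: ennreal_less_iff)
    \<comment> \<open>The solution of \<open>c / \<gamma>' = c / \<gamma> + \<eta>\<close>, so that
      lowering the density costs exactly one share.\<close>
    define \<gamma>' where "\<gamma>' = c / (c / \<gamma> + \<eta>)"
    have \<gamma>': "\<gamma>' > 0" using c \<eta> assms(3) by (auto simp: \<gamma>'_def intro!: divide_pos_pos add_pos_pos)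
    have c\<gamma>': "c / \<gamma>' = c / \<gamma> + \<eta>" using c by (simp add: \<gamma>'_def)
    have "\<gamma>' < \<gamma>"
    proof (rule ccontr)
      assume "\<not> \<gamma>' < \<gamma>"
      then have "c / \<gamma>' \<le> c / \<gamma>" using assms(3) c by (intro divide_left_mono) auto
      with c\<gamma>' \<eta> show False by simp
    qed
    then have "ennreal \<gamma>' < IC_density l S"
      unfolding dens using \<gamma>' by (simp add: ennreal_less_iff)
    then have freq: "\<exists>\<^sub>F a in at_top. ennreal \<gamma>' < npts (S \<inter> Cb a l) / ennreal (a ^ (2 * l))"
      unfolding IC_density_def by (rule less_Limsup_frequently)
    have "IC_density l S < \<infinity>" by (simp add: dens)
    then have fin: "\<forall>\<^sub>F a in at_top. finite (S \<inter> Cb a l)" by (rule finite_IC_inter_Cb)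
    have "((\<lambda>a. c / \<gamma>' * ((a + 2 * \<rho>) / a) ^ (2 * l)) \<longlongrightarrow> c / \<gamma>' * 1) at_top"
      by (intro tendsto_mult tendsto_const tendsto_power_shift_ratio)
    then have lim: "\<forall>\<^sub>F a in at_top. c / \<gamma>' * ((a + 2 * \<rho>) / a) ^ (2 * l) < c / \<gamma>' * 1 + \<eta>"
      using \<eta> by (intro order_tendstoD(2)) auto
    \<comment> \<open>The density bound holds only frequently; the facts that hold eventually are
      joined to it here.\<close>
    have "\<forall>\<^sub>F a in at_top. ennreal \<gamma>' < npts (S \<inter> Cb a l) / ennreal (a ^ (2 * l)) \<longrightarrow>
        (finite (S \<inter> Cb a l) \<and>
        c / \<gamma>' * ((a + 2 * \<rho>) / a) ^ (2 * l) < c / \<gamma>' * 1 + \<eta> \<and> a > 0) \<and>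
        ennreal \<gamma>' < npts (S \<inter> Cb a l) / ennreal (a ^ (2 * l))"
      using fin lim eventually_gt_at_top[of "0::real"] by eventually_elim simp
    then have "\<exists>\<^sub>F a in at_top. (finite (S \<inter> Cb a l) \<and>
        c / \<gamma>' * ((a + 2 * \<rho>) / a) ^ (2 * l) < c / \<gamma>' * 1 + \<eta> \<and> a > 0) \<and>
        ennreal \<gamma>' < npts (S \<inter> Cb a l) / ennreal (a ^ (2 * l))"
      by (rule frequently_rev_mp[OF freq])
    then show "\<exists>\<^sub>F a in at_top. y' <
        ennreal ((\<Sum>s\<in>S \<inter> Cb a l. err \<sigma> S s) / real (card (S \<inter> Cb a l)))"
    proof (rule frequently_elim1)
      fix a assume a: "(finite (S \<inter> Cb a l) \<and>
        c / \<gamma>' * ((a + 2 * \<rho>) / a) ^ (2 * l) < c / \<gamma>' * 1 + \<eta> \<and> a > 0) \<and>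
        ennreal \<gamma>' < npts (S \<inter> Cb a l) / ennreal (a ^ (2 * l))"
      define M where "M = real (card (S \<inter> Cb a l))"
      define W where "W = (\<Sum>s\<in>S \<inter> Cb a l. err \<sigma> S s)"
      define V where "V = (a + 2 * \<rho>) ^ (2 * l)"
      have ap: "a ^ (2 * l) > 0" using a by simp
      have "npts (S \<inter> Cb a l) / ennreal (a ^ (2 * l)) = ennreal (M / a ^ (2 * l))"
        using a by (simp only: npts_finite M_def) (rule divide_ennreal[OF of_nat_0_le_iff ap])
      then have "ennreal \<gamma>' < ennreal (M / a ^ (2 * l))"
        using a by simp
      then have "\<gamma>' < M / a ^ (2 * l)" using \<gamma>' by (simp add: ennreal_less_iff)
      then have M\<gamma>: "\<gamma>' * a ^ (2 * l) < M" using ap by (simp add: field_simps)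
      then have M: "M > 0" using \<gamma>' ap by (meson less_trans mult_pos_pos)
      have W: "W \<ge> 0" unfolding W_def by (intro sum_nonneg err_nonneg)
      have V: "V \<ge> 0" unfolding V_def using a \<rho> by simp
      have "of_nat (card (S \<inter> Cb a l)) * (ennreal T + ennreal c * ennreal (1 / \<gamma>)) \<le>
          ennreal W * ennreal z + ennreal c * ennreal V + of_nat (card (S \<inter> Cb a l)) * ennreal E"
        using sum_err_ge[OF assms(1,2), of "S \<inter> Cb a l" a \<rho> R] a \<rho>(1)
        unfolding T(2) E(2) Z(1) vol c_def[symmetric] W_def[symmetric] V_def[symmetric] by blast
      moreover have "of_nat (card (S \<inter> Cb a l)) = ennreal M"
        by (simp add: M_def ennreal_of_nat_eq_real_of_nat)
      moreover note nn = less_imp_le[OF M] T(1) less_imp_le[OF c] W V E(1) less_imp_le[OF Z(2)]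
      moreover have "1 / \<gamma> \<ge> 0" using assms(3) by simp
      ultimately have "ennreal (M * (T + c * (1 / \<gamma>))) \<le> ennreal (W * z + c * V + M * E)"
        by (simp only: ennreal_mult ennreal_plus mult_nonneg_nonneg add_nonneg_nonneg)
      then have "M * (T + c * (1 / \<gamma>)) \<le> W * z + c * V + M * E"
        using nn by (subst (asm) ennreal_le_iff) auto
      then have main: "M * (T + c / \<gamma>) \<le> W * z + c * V + M * E" by simp
      \<comment> \<open>More than \<open>\<gamma>' * a ^ (2 * l)\<close> points share the volume
        \<open>V\<close>, and \<open>V\<close> is asymptotically the volume of the original
        cube.\<close>
      have "c * V / M \<le> c * V / (\<gamma>' * a ^ (2 * l))"
        using M\<gamma> \<gamma>' ap c V M by (intro divide_left_mono mult_nonneg_nonneg) auto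
      also have "\<dots> = c / \<gamma>' * ((a + 2 * \<rho>) / a) ^ (2 * l)"
        by (simp add: V_def power_divide)
      also have "\<dots> < c / \<gamma> + 2 * \<eta>" using a c\<gamma>' by simp
      finally have cV: "c * V / M < c / \<gamma> + 2 * \<eta>" .
      have "T + c / \<gamma> \<le> (W * z + c * V + M * E) / M"
        using main M by (simp add: field_simps)
      also have "\<dots> = W * z / M + c * V / M + E"
        using M by (simp add: add_divide_distrib)
      finally have "T - 3 * \<eta> < W * z / M" using cV E\<eta> by linarith
      moreover have "3 * \<eta> = T - y * z" by (simp add: \<eta>_def)
      ultimately have "y * z < W / M * z" by simp
      then have "y < W / M" using mult_less_cancel_right_pos[OF Z(2), of y "W / M"] by blast
      then show "y' < ennreal ((\<Sum>s\<in>S \<inter> Cb a l. err \<sigma> S s) / real (card (S \<inter> Cb a l)))"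
        using y unfolding W_def[symmetric] M_def[symmetric] by (simp add: ennreal_less_iff)
    qed
  qed
qed

end

section \<open>Almost sure full rank\<close>

text \<open>Polynomial dependence is used one coordinate at a time, hence univariate
  polynomials.\<close>

definition poly_fun :: "(complex \<Rightarrow> complex) \<Rightarrow> bool" where
  "poly_fun g \<longleftrightarrow> (\<exists>p. \<forall>z. g z = poly p z)"

lemma poly_fun_const: "poly_fun (\<lambda>_. c)"
  unfolding poly_fun_def by (rule exI[of _ "[:c:]"]) simp

lemma poly_fun_id: "poly_fun (\<lambda>z. z)"
  unfolding poly_fun_def by (rule exI[of _ "[:0, 1:]"]) simp

lemma poly_fun_add: "poly_fun f \<Longrightarrow> poly_fun g \<Longrightarrow> poly_fun (\<lambda>z. f z + g z)"
  unfolding poly_fun_def by (metis poly_add)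

lemma poly_fun_mult: "poly_fun f \<Longrightarrow> poly_fun g \<Longrightarrow> poly_fun (\<lambda>z. f z * g z)"
  unfolding poly_fun_def by (metis poly_mult)

lemma poly_fun_sum: "(\<And>i. i \<in> I \<Longrightarrow> poly_fun (f i)) \<Longrightarrow> poly_fun (\<lambda>z. \<Sum>i\<in>I. f i z)"
  by (induction I rule: infinite_finite_induct) (auto intro: poly_fun_const poly_fun_add)

lemma poly_fun_prod: "(\<And>i. i \<in> I \<Longrightarrow> poly_fun (f i)) \<Longrightarrow> poly_fun (\<lambda>z. \<Prod>i\<in>I. f i z)"
  by (induction I rule: infinite_finite_induct) (auto intro: poly_fun_const poly_fun_mult)

lemma poly_fun_AE_nonzero:
  assumes "poly_fun g" "g w \<noteq> 0"
  shows "AE z in CN s. g z \<noteq> 0"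
proof -
  obtain p where p: "\<And>z. g z = poly p z" using assms(1) by (auto simp: poly_fun_def)
  with assms(2) have "p \<noteq> 0" by auto
  then have "finite {z. poly p z = 0}" by (rule poly_roots_finite)
  then have "{z. poly p z = 0} \<in> null_sets lborel" by (rule finite_imp_null_set_lborel)
  then have "AE z in lborel. g z \<noteq> 0" by (rule AE_I') (simp add: p)
  then show ?thesis by (rule AE_CN)
qed

lemma AE_PiM_CN_nonzero:
  fixes f :: "('i \<Rightarrow> complex) \<Rightarrow> complex"
  assumes "0 < s" "finite I"
    and "\<And>i x. i \<in> I \<Longrightarrow> poly_fun (\<lambda>z. f (x(i := z)))"
    and "f \<in> borel_measurable (LC I)"
    and "\<And>x y. (\<And>i. i \<in> I \<Longrightarrow> x i = y i) \<Longrightarrow> f x = f y"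
    and "f x0 \<noteq> 0"
  shows "AE x in PiM I (\<lambda>_. CN s). f x \<noteq> 0"
  using assms(2-)
proof (induction I arbitrary: f rule: finite_induct)
  case empty
  have "f x \<noteq> 0" for x
  proof
    assume "f x = 0"
    moreover have "f x = f x0" by (rule empty.prems(3)) simp
    ultimately show False using empty.prems(4) by simp
  qed
  then show ?case by (intro AE_I2)
next
  case (insert i I)
  interpret CN: prob_space "CN s" by (rule prob_space_CN) fact
  interpret product_sigma_finite "\<lambda>_::'i. CN s" by standard
  have f: "f \<in> borel_measurable (PiM (insert i I) (\<lambda>_. CN s))"
    unfolding measurable_cong_sets[OF sets_PiM_CN refl] by (rule insert.prems(2))
  define f' where "f' = (\<lambda>x. f (x(i := x0 i)))"
  have upd: "(\<lambda>x. x(i := x0 i)) \<in> LC I \<rightarrow>\<^sub>M LC (insert i I)"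
    by (rule measurable_fun_upd[where J = I]) auto
  have "AE x in PiM I (\<lambda>_. CN s). f' x \<noteq> 0"
  proof (rule insert.IH)
    fix j x assume j: "j \<in> I"
    then have "j \<noteq> i" using insert.hyps(2) by auto
    then have "(\<lambda>z. f' (x(j := z))) = (\<lambda>z. f ((x(i := x0 i))(j := z)))"
      by (simp add: f'_def fun_upd_twist)
    then show "poly_fun (\<lambda>z. f' (x(j := z)))"
      by (simp only:) (rule insert.prems(1), use j in simp)
  next
    show "f' \<in> borel_measurable (LC I)"
      unfolding f'_def by (rule measurable_compose[OF upd insert.prems(2)])
    show "f' x = f' y" if "\<And>j. j \<in> I \<Longrightarrow> x j = y j" for x y
      unfolding f'_def by (rule insert.prems(3)) (use that in auto)
    show "f' x0 \<noteq> 0" using insert.prems(4) by (simp add: f'_def)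
  qed
  then have ae: "AE x in PiM I (\<lambda>_. CN s). (\<integral>\<^sup>+z. indicator {0} (f (x(i := z))) \<partial>CN s) = 0"
  proof eventually_elim
    case (elim x)
    have "AE z in CN s. f (x(i := z)) \<noteq> 0"
      by (rule poly_fun_AE_nonzero[OF insert.prems(1)[OF insertI1] elim[unfolded f'_def]])
    then have "AE z in CN s. indicator {0} (f (x(i := z))) = (0::ennreal)"
      by eventually_elim simp
    then have "(\<integral>\<^sup>+z. indicator {0} (f (x(i := z))) \<partial>CN s) = (\<integral>\<^sup>+z. 0 \<partial>CN s)"
      by (rule nn_integral_cong_AE)
    then show ?case by simp
  qed
  have "(\<integral>\<^sup>+x. indicator {0} (f x) \<partial>PiM (insert i I) (\<lambda>_. CN s)) =
      (\<integral>\<^sup>+x. \<integral>\<^sup>+z. indicator {0} (f (x(i := z))) \<partial>CN s \<partial>PiM I (\<lambda>_. CN s))"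
    using insert.hyps f by (intro product_nn_integral_insert) auto
  also have "\<dots> = (\<integral>\<^sup>+x. 0 \<partial>PiM I (\<lambda>_. CN s))"
    by (rule nn_integral_cong_AE) (use ae in simp)
  finally have "AE x in PiM (insert i I) (\<lambda>_. CN s). indicator {0} (f x) = (0::ennreal)"
    using f by (subst nn_integral_0_iff_AE[symmetric]) auto
  then show ?case by eventually_elim (simp split: split_indicator_asm)
qed

text \<open>The minor formed by the first \<open>t\<close> rows, which exist because
  \<open>t \<le> r\<close>, is polynomial in each entry and equals 1 at the identity.\<close>

lemma AE_chan_minor_nonzero:
  assumes "t \<le> r" "i < n"
  shows "AE H in chan n r t. cdet t (\<lambda>j k. H (i, j, k)) \<noteq> 0"
  unfolding chan_def
proof (rule AE_PiM_CN_nonzero)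
  have idx: "(i, j, p j) \<in> {..<n} \<times> {..<r} \<times> {..<t}" if "p permutes {..<t}" "j < t" for p j
    using permutes_in_image[OF that(1), of j] that assms by auto
  show "poly_fun (\<lambda>z. cdet t (\<lambda>j k. (H(a := z)) (i, j, k)))" for a H
  proof -
    have "poly_fun (\<lambda>z. (H(a := z)) b)" for b
      by (cases "a = b") (auto intro: poly_fun_const poly_fun_id)
    then show ?thesis
      unfolding cdet_def by (intro poly_fun_sum poly_fun_mult poly_fun_prod poly_fun_const)
  qed
  have "(\<lambda>H. H b) \<in> borel_measurable (LC ({..<n} \<times> {..<r} \<times> {..<t}))"
    if "b \<in> {..<n} \<times> {..<r} \<times> {..<t}" for b
    using measurable_component_singleton[OF that, of "\<lambda>_. lborel"] by simp
  then show "(\<lambda>H. cdet t (\<lambda>j k. H (i, j, k))) \<in> borel_measurable (LC ({..<n} \<times> {..<r} \<times> {..<t}))"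
    unfolding cdet_def
    by (intro borel_measurable_sum borel_measurable_times borel_measurable_const borel_measurable_prod)
       (use idx in auto)
  show "cdet t (\<lambda>j k. x (i, j, k)) = cdet t (\<lambda>j k. y (i, j, k))"
    if "\<And>b. b \<in> {..<n} \<times> {..<r} \<times> {..<t} \<Longrightarrow> x b = y b" for x y
    unfolding cdet_def
    by (intro sum.cong refl arg_cong2[where f = "(*)"] prod.cong) (use that idx in auto)
  show "cdet t (\<lambda>j k. (\<lambda>(i, j, k). if j = k then 1 else 0) (i, j, k)) \<noteq> 0"
    using hermitian_pd_scalar(3)[of 1 t, unfolded of_real_1] by simp
qed auto

text \<open>The rows \<open>i * r + j\<close> with \<open>j < t\<close> involve only the unknowns
  \<open>i * t + k\<close> of block \<open>i\<close>, and their coefficients form the invertible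
  minor.\<close>

lemma full_rank_Hblock:
  assumes "1 \<le> t" "t \<le> r" "\<And>i. i < n \<Longrightarrow> cdet t (\<lambda>j k. H (i, j, k)) \<noteq> 0"
  shows "full_rank (n * r) (n * t) (Hblock r t H)"
proof
  fix x a assume 0: "\<And>c. c < n * r \<Longrightarrow> mat_app (n * t) (Hblock r t H) x c = 0" and a: "a < n * t"
  define i where "i = a div t"
  have i: "i < n" using a assms(1) by (simp add: i_def less_mult_imp_div_less)
  obtain g where g: "\<And>a b. a < t \<Longrightarrow> b < t \<Longrightarrow> (\<Sum>k<t. g a k * H (i, k, b)) = (if a = b then 1 else 0)"
    by (rule cdet_nonzero_inverse[OF assms(3)[OF i]]) blast
  have row: "(\<Sum>k<t. H (i, j, k) * x (i * t + k)) = 0" if j: "j < t" for j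
  proof -
    have c: "i * r + j < n * r" 
    proof -
      have "i * r + j < Suc i * r" using j assms(2) by simp
      also have "\<dots> \<le> n * r" using i by (intro mult_right_mono) auto
      finally show ?thesis .
    qed
    have "(\<Sum>k<t. H (i, j, k) * x (i * t + k)) =
        (\<Sum>b\<in>(\<lambda>k. i * t + k) ` {..<t}. Hblock r t H (i * r + j) b * x b)"
      using j assms by (subst sum.reindex) (auto simp: Hblock_def inj_on_def intro!: sum.cong)
    also have "\<dots> = (\<Sum>b<n * t. Hblock r t H (i * r + j) b * x b)"
    proof (rule sum.mono_neutral_left)
      show "(\<lambda>k. i * t + k) ` {..<t} \<subseteq> {..<n * t}"
      proof safe
        fix k assume "k < t"
        then have "i * t + k < Suc i * t" by simp
        also have "\<dots> \<le> n * t" using i by (intro mult_right_mono) auto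
        finally show "i * t + k < n * t" .
      qed
      show "\<forall>b\<in>{..<n * t} - (\<lambda>k. i * t + k) ` {..<t}. Hblock r t H (i * r + j) b * x b = 0"
      proof
        fix b assume b: "b \<in> {..<n * t} - (\<lambda>k. i * t + k) ` {..<t}"
        have "b div t \<noteq> i"
        proof
          assume "b div t = i"
          then have "b = i * t + b mod t" using div_mult_mod_eq[of b t] by simp
          moreover have "b mod t < t" using assms(1) by simp
          ultimately show False using b by blast
        qed
        then show "Hblock r t H (i * r + j) b * x b = 0"
          using j assms by (simp add: Hblock_def)
      qed
    qed simp
    also have "\<dots> = 0" using 0[OF c] by (simp add: mat_app_def)
    finally show ?thesis .
  qed
  have at: "a mod t < t" using assms(1) by simp
  \<comment> \<open>Applying the inverse minor to the block equations isolates a single entry of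
    \<open>x\<close>.\<close>
  have "x a = x (i * t + a mod t)" by (simp add: i_def)
  also have "\<dots> = (\<Sum>b<t. if a mod t = b then x (i * t + b) else 0)"
    using at by simp
  also have "\<dots> = (\<Sum>b<t. (\<Sum>k<t. g (a mod t) k * H (i, k, b)) * x (i * t + b))"
    using at by (intro sum.cong) (auto simp: g)
  also have "\<dots> = (\<Sum>k<t. g (a mod t) k * (\<Sum>b<t. H (i, k, b) * x (i * t + b)))"
    unfolding sum_distrib_left sum_distrib_right by (subst sum.swap) (simp add: mult.assoc)
  also have "\<dots> = 0" by (simp add: row)
  finally show "x a = 0" .
qed

lemma AE_chan_full_rank:
  assumes "1 \<le> t" "t \<le> r"
  shows "AE H in chan n r t. full_rank (n * r) (n * t) (Hblock r t H)"
proof -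
  have "AE H in chan n r t. \<forall>i\<in>{..<n}. cdet t (\<lambda>j k. H (i, j, k)) \<noteq> 0"
    by (intro AE_finite_allI AE_chan_minor_nonzero[OF assms(2)]) auto
  then show ?thesis
    by eventually_elim (use assms in \<open>auto intro!: full_rank_Hblock\<close>)
qed

section \<open>Averaging over the channel\<close>

lemma gram_det_eq: "gram_det n r t H = Re (cdet (n * t) (gram (n * r) (Hblock r t H)))"
  by (simp add: gram_det_def gram_def[abs_def])

lemma Happ_eq: "c < n * r \<Longrightarrow> Happ n r t H x c = mat_app (n * t) (Hblock r t H) x c"
  by (simp add: Happ_def mat_app_def)

text \<open>Full rank makes the channel injective on \<open>cvec (n * t)\<close>. Received points
  may therefore be counted and summed through the transmitted ones, and the intersection of the
  images is the image of the intersection.\<close>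

lemma avg_err_eq:
  assumes "full_rank (n * r) (n * t) (Hblock r t H)" "S \<subseteq> cvec (n * t)"
  shows "avg_err n r t s2 S H a =
    (\<Sum>s\<in>S \<inter> Cb a (n * t). full_rank.err (n * r) (n * t) (Hblock r t H) s2 S s) /
      real (card (S \<inter> Cb a (n * t)))"
proof -
  interpret full_rank "n * r" "n * t" "Hblock r t H" by fact
  let ?h = "Happ n r t H"
  have inj: "inj_on ?h (cvec (n * t))"
  proof
    fix x y assume xy: "x \<in> cvec (n * t)" "y \<in> cvec (n * t)" "?h x = ?h y"
    have "mat_app (n * t) (Hblock r t H) (\<lambda>i. x i - y i) c = 0" if "c < n * r" for c
      unfolding mat_app_diff using that xy(3) by (simp flip: Happ_eq)
    then have *: "x i - y i = 0" if "i < n * t" for i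
      using inj[of "\<lambda>i. x i - y i" i] that by blast
    show "x = y"
    proof
      fix i show "x i = y i"
        using *[of i] xy(1,2) by (cases "i < n * t") (auto simp: cvec_def)
    qed
  qed
  have Cb: "Cb a (n * t) \<subseteq> cvec (n * t)" by (auto simp: Cb_def)
  have img: "?h ` S \<inter> ?h ` Cb a (n * t) = ?h ` (S \<inter> Cb a (n * t))"
    using inj assms(2) Cb by (rule inj_on_image_Int[symmetric])
  have injC: "inj_on ?h (S \<inter> Cb a (n * t))"
    by (rule inj_on_subset[OF inj]) (use Cb in auto)
  have "measure (noise (n * r) s2) {z \<in> space (noise (n * r) s2).
      (\<lambda>i. ?h s i + z i) \<notin> voronoi (n * r) (?h ` S) (?h s)} = err s2 S s" for s
  proof -
    have "cnorm2 (n * r) (\<lambda>i. ?h s i + z i - ?h p i) =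
        cnorm2 (n * r) (\<lambda>c. z c + mat_app (n * t) (Hblock r t H) (\<lambda>i. s i - p i) c)" for z p
      by (rule cnorm2_cong) (simp add: Happ_eq mat_app_diff)
    then show ?thesis by (simp add: err_def voronoi_def)
  qed
  then show ?thesis
    unfolding avg_err_def Let_def img by (simp add: sum.reindex[OF injC] card_image[OF injC])
qed

lemma Vball_eq: "1 \<le> k \<Longrightarrow> Vball k = pi ^ k / fact k"
  using Gamma_fact[of "k - 1", where 'a = real] by (cases k) (simp_all add: Vball_def)

text \<open>The channel is fixed here. \<open>nn_integral_q\<close> transports the ball volume and
  the Gaussian mass outside the ball from \<open>q\<close> to the squared norm with the same factor
  \<open>1 / d\<close>; in the mass it cancels against the normalising integral
  \<open>P / d\<close>.\<close>

lemma conditional_bound: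
  assumes fr: "full_rank (n * r) (n * t) (Hblock r t H)"
    and nt: "1 \<le> n" "1 \<le> t" and s2: "0 < s2" and S: "countable S" "S \<subseteq> cvec (n * t)"
    and dens: "0 < IC_density (n * t) S" "IC_density (n * t) S < \<infinity>"
  shows "emeasure (noise (n * t) s2) {z \<in> space (noise (n * t) s2). cnorm2 (n * t) z \<ge>
      exp (- NLD n t S / real t) * (gram_det n r t H / Vball (n * t)) powr (1 / real (n * t))}
    \<le> Limsup at_top (\<lambda>a. ennreal (avg_err n r t s2 S H a))"
proof -
  define l where "l = n * t"
  have l: "1 \<le> l" using nt by (simp add: l_def)
  interpret full_rank "n * r" l "Hblock r t H" using fr by (simp add: l_def)
  obtain d where d: "d > 0" "cdet l (gram (n * r) (Hblock r t H)) = of_real d"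
    and int: "\<And>f. f \<in> borel_measurable borel \<Longrightarrow>
      (\<integral>\<^sup>+u. f (q u) \<partial>LC {..<l}) = ennreal (1 / d) * (\<integral>\<^sup>+u. f (cnorm2 l u) \<partial>LC {..<l})"
    by (rule nn_integral_q) blast
  have gd: "gram_det n r t H = d" by (simp add: gram_det_eq l_def[symmetric] d)
  obtain \<gamma> where \<gamma>: "\<gamma> > 0" "IC_density l S = ennreal \<gamma>"
    using dens by (cases "IC_density l S") (auto simp: l_def[symmetric])
  define R where "R = exp (- NLD n t S / real t) * (d / Vball l) powr (1 / real l)"
  have V: "Vball l > 0" using l by (simp add: Vball_eq)
  have R: "R > 0" using d V by (simp add: R_def)
  \<comment> \<open>\<open>R\<close> is the threshold for which \<open>Vball l * R ^ l / d\<close>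
    equals \<open>1 / \<gamma>\<close>. Since \<open>l = n * t\<close> and the NLD is
    \<open>ln \<gamma> / n\<close>, the \<open>l\<close>-th power of the exponential factor is
    \<open>1 / \<gamma>\<close>.\<close>
  have "R ^ l = exp (- NLD n t S / real t) ^ l * ((d / Vball l) powr (1 / real l)) ^ l"
    by (simp add: R_def power_mult_distrib)
  also have "((d / Vball l) powr (1 / real l)) ^ l = d / Vball l"
    using l d V by (simp add: powr_power)
  also have "exp (- NLD n t S / real t) ^ l = exp (- ln \<gamma>)"
    using nt \<gamma> by (simp add: NLD_def exp_of_nat_mult[symmetric] l_def[symmetric])
      (simp add: l_def)
  also have "exp (- ln \<gamma>) = 1 / \<gamma>" using \<gamma> by (simp add: exp_minus inverse_eq_divide)
  finally have Rl: "R ^ l = 1 / \<gamma> * (d / Vball l)" .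
  have "emeasure (LC {..<l}) {u \<in> space (LC {..<l}). q u < R} =
      (\<integral>\<^sup>+u. indicator {u \<in> space (LC {..<l}). q u < R} u \<partial>LC {..<l})"
    by (rule nn_integral_indicator[symmetric]) measurable
  also have "\<dots> = (\<integral>\<^sup>+u. indicator {..<R} (q u) \<partial>LC {..<l})"
    by (rule nn_integral_cong) (simp split: split_indicator)
  also have "\<dots> = ennreal (1 / d) * (\<integral>\<^sup>+u. indicator {..<R} (cnorm2 l u) \<partial>LC {..<l})"
    by (rule int) simp
  also have "(\<integral>\<^sup>+u. indicator {..<R} (cnorm2 l u) \<partial>LC {..<l}) =
      (\<integral>\<^sup>+u. indicator {u \<in> space (LC {..<l}). cnorm2 l u < R} u \<partial>LC {..<l})"
    by (rule nn_integral_cong) (simp split: split_indicator)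
  also have "\<dots> = emeasure (LC {..<l}) {u \<in> space (LC {..<l}). cnorm2 l u < R}"
    by (rule nn_integral_indicator) measurable
  also have "\<dots> = ennreal (Vball l * R ^ l)"
    using emeasure_cnorm2_less[OF R] l by (simp add: Vball_eq)
  also have "ennreal (1 / d) * \<dots> = ennreal (1 / \<gamma>)"
    using d V \<gamma> by (subst ennreal_mult'[symmetric]) (auto simp: Rl)
  finally have vol: "emeasure (LC {..<l}) {u \<in> space (LC {..<l}). q u < R} = ennreal (1 / \<gamma>)" .
  define P where "P = (pi * s2) ^ l"
  have P: "P > 0" using s2 by (simp add: P_def)
  have Z: "(\<integral>\<^sup>+u. ennreal (exp (- q u / s2)) \<partial>LC {..<l}) = ennreal (P / d)"
  proof -
    have "(\<integral>\<^sup>+u. ennreal (exp (- q u / s2)) \<partial>LC {..<l}) =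
        ennreal (1 / d) * (\<integral>\<^sup>+u. ennreal (exp (- cnorm2 l u / s2)) \<partial>LC {..<l})"
      by (rule int[of "\<lambda>x. ennreal (exp (- x / s2))"]) simp
    also have "\<dots> = ennreal (1 / d) * ennreal P"
      unfolding nn_integral_gaussian_LC[OF s2] P_def ..
    also have "\<dots> = ennreal (1 / d * P)" using P by (intro ennreal_mult'[symmetric]) (use d in simp)
    finally show ?thesis by simp
  qed
  let ?A = "{z \<in> space (noise l s2). R \<le> cnorm2 l z}"
  let ?J = "\<integral>\<^sup>+u. ennreal (exp (- cnorm2 l u / s2)) * indicator {R..} (cnorm2 l u) \<partial>LC {..<l}"
  have "?A = {z \<in> space (LC {..<l}). R \<le> cnorm2 l z}"
    using sets_eq_imp_space_eq[OF sets_noise[of l s2]] by simp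
  also have "\<dots> \<in> sets (LC {..<l})" by measurable
  finally have A: "?A \<in> sets (LC {..<l})" .
  have "emeasure (noise l s2) ?A =
      (\<integral>\<^sup>+z. ennreal (exp (- cnorm2 l z / s2) / (pi * s2) ^ l) * indicator ?A z \<partial>LC {..<l})"
    by (subst (1) noise_eq_density[OF s2]) (use A in \<open>intro emeasure_density; simp\<close>)
  also have "\<dots> = (\<integral>\<^sup>+z. ennreal (1 / P) *
      (ennreal (exp (- cnorm2 l z / s2)) * indicator {R..} (cnorm2 l z)) \<partial>LC {..<l})"
  proof (rule nn_integral_cong)
    fix z assume z: "z \<in> space (LC {..<l})"
    then have "z \<in> space (noise l s2)"
      using sets_eq_imp_space_eq[OF sets_noise[of l s2]] by simp
    then have "indicator ?A z = (indicator {R..} (cnorm2 l z) :: ennreal)"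
      by (simp split: split_indicator)
    moreover have "ennreal (exp (- cnorm2 l z / s2) / (pi * s2) ^ l) =
        ennreal (1 / P) * ennreal (exp (- cnorm2 l z / s2))"
      using P by (subst ennreal_mult'[symmetric]) (auto simp: P_def)
    ultimately show "ennreal (exp (- cnorm2 l z / s2) / (pi * s2) ^ l) * indicator ?A z =
        ennreal (1 / P) * (ennreal (exp (- cnorm2 l z / s2)) * indicator {R..} (cnorm2 l z))"
      by (simp only: mult.assoc)
  qed
  also have "\<dots> = ennreal (1 / P) * ?J"
    by (rule nn_integral_cmult) measurable
  also have "\<dots> = ennreal (1 / d) * ?J / ennreal (P / d)"
  proof -
    have "ennreal (1 / P) = ennreal (1 / d / (P / d))" using d by simp
    also have "\<dots> = ennreal (1 / d) / ennreal (P / d)"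
      using d P by (intro divide_ennreal[symmetric]) auto
    finally have "ennreal (1 / P) * ?J = ?J * (ennreal (1 / d) / ennreal (P / d))"
      by (simp only: mult.commute)
    also have "\<dots> = ?J * ennreal (1 / d) / ennreal (P / d)"
      by (rule ennreal_times_divide)
    finally show ?thesis by (simp only: mult.commute[of ?J])
  qed
  also have "ennreal (1 / d) * ?J =
      (\<integral>\<^sup>+u. ennreal (exp (- q u / s2)) * indicator {R..} (q u) \<partial>LC {..<l})"
    by (rule int[of "\<lambda>x. ennreal (exp (- x / s2)) * indicator {R..} x", symmetric]) measurable
  also have "\<dots> / ennreal (P / d) \<le> Limsup at_top
      (\<lambda>a. ennreal ((\<Sum>s\<in>S \<inter> Cb a l. err s2 S s) / real (card (S \<inter> Cb a l))))"
    by (rule Limsup_avg_err_ge[OF S(1) s2 \<gamma> vol Z]) (use d P in simp)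
  also have "\<dots> = Limsup at_top (\<lambda>a. ennreal (avg_err n r t s2 S H a))"
    unfolding l_def avg_err_eq[OF fr S(2)] ..
  finally show ?thesis
    unfolding gd R_def l_def .
qed

text \<open>Every entry in the Gram matrix is read inside the index set of the product;
  \<open>1 \<le> t\<close> keeps \<open>a mod t\<close> below \<open>t\<close>.\<close>

lemma borel_measurable_gram_det:
  assumes "1 \<le> t"
  shows "gram_det n r t \<in> borel_measurable (chan n r t)"
proof -
  have [measurable]: "(\<lambda>H. Hblock r t H c a) \<in> borel_measurable (chan n r t)"
    if "c < n * r" for c a
  proof (cases "c div r = a div t")
    case True
    have "0 < r" using that by (cases r) auto
    then have "(c div r, c mod r, a mod t) \<in> {..<n} \<times> {..<r} \<times> {..<t}"
      using that assms by (auto simp: less_mult_imp_div_less)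
    then have "(\<lambda>H. H (c div r, c mod r, a mod t)) \<in> chan n r t \<rightarrow>\<^sub>M CN 1"
      unfolding chan_def by (rule measurable_component_singleton)
    then show ?thesis
      using True unfolding measurable_cong_sets[OF refl sets_CN] by (simp add: Hblock_def)
  qed (simp add: Hblock_def)
  show ?thesis
    unfolding gram_det_def cdet_def by measurable
qed

theorem theorem5p2:
  fixes n r t :: nat and s2 \<delta> :: real and S :: "(nat \<Rightarrow> complex) set"
  assumes "1 \<le> n" and "1 \<le> t" and "t \<le> r" and "0 < s2"
    and "countable S" and "S \<subseteq> cvec (n * t)"
    and "0 < IC_density (n * t) S" and "IC_density (n * t) S < \<infinity>"
    and "\<delta> = NLD n t S"
  shows "emeasure (chan n r t \<Otimes>\<^sub>M noise (n * t) s2)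
           {p \<in> space (chan n r t \<Otimes>\<^sub>M noise (n * t) s2).
              cnorm2 (n * t) (snd p) \<ge>
                exp (- \<delta> / real t) * (gram_det n r t (fst p) / Vball (n * t)) powr (1 / real (n * t))}
         \<le> error_prob n r t s2 S"
proof -
  let ?A = "{p \<in> space (chan n r t \<Otimes>\<^sub>M noise (n * t) s2).
              cnorm2 (n * t) (snd p) \<ge>
                exp (- \<delta> / real t) * (gram_det n r t (fst p) / Vball (n * t)) powr (1 / real (n * t))}"
  interpret N: prob_space "noise (n * t) s2"
    using assms(4) by (rule prob_space_noise)
  have [measurable]: "cnorm2 (n * t) \<in> borel_measurable (noise (n * t) s2)"
    unfolding measurable_cong_sets[OF sets_noise refl] by (rule borel_measurable_cnorm2)
  have [measurable]: "gram_det n r t \<in> borel_measurable (chan n r t)"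
    by (rule borel_measurable_gram_det) fact
  \<comment> \<open>Independence of channel and noise is expressed by the product measure; slicing
    at a fixed \<open>H\<close> leaves a statement about the noise alone.\<close>
  have "emeasure (chan n r t \<Otimes>\<^sub>M noise (n * t) s2) ?A =
      (\<integral>\<^sup>+H. emeasure (noise (n * t) s2) (Pair H -` ?A) \<partial>chan n r t)"
    by (rule N.emeasure_pair_measure_alt) measurable
  also have "\<dots> = (\<integral>\<^sup>+H. emeasure (noise (n * t) s2) {z \<in> space (noise (n * t) s2). cnorm2 (n * t) z \<ge>
      exp (- NLD n t S / real t) * (gram_det n r t H / Vball (n * t)) powr (1 / real (n * t))} \<partial>chan n r t)"
    by (intro nn_integral_cong arg_cong2[where f = emeasure] refl)
       (auto simp: space_pair_measure assms(9))
  \<comment> \<open>The conditional bound is available for channels of full column rank, hence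
    almost surely.\<close>
  also have "\<dots> \<le> (\<integral>\<^sup>+H. Limsup at_top (\<lambda>a. ennreal (avg_err n r t s2 S H a)) \<partial>chan n r t)"
    using AE_chan_full_rank[OF assms(2,3), of n]
    by (intro nn_integral_mono_AE, eventually_elim)
       (use assms in \<open>intro conditional_bound\<close>)
  finally show ?thesis unfolding error_prob_def .
qed

end
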